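(* The class $\mathit{MS}$ of all disjunction-free multiplicity schemas is learnable in polynomial time and data from positive and negative examples, i.e., in the learning setting $(\mathit{Tree}^{\pm},\mathit{MS},L^{\pm})$, where $\mathit{Tree}^{\pm}=\mathit{Tree}\times\{+,-\}$ and, for a schema $S$, $L^{\pm}(S)=\{(t,+)\mid t\in L(S)\}\cup\{(t,-)\mid t\in\mathit{Tree}\setminus L(S)\}$.
   Context: **Alphabet.** $\Sigma$ is a finite alphabet with a total order testable in constant time. The alphabet is given as part of the input, and polynomial bounds are uniform in $\Sigma$. **Unordered words.** An unordered word is a multiset of symbols, i.e., a function $w:\Sigma\to\mathbb{N}_0$. **Disjunction-free multiplicity expressions.** A multiplicity is an element of $\{*,+,?,0,1\}$, with $[\![*]\!]=\{0,1,2,\ldots\}$, $[\![+]\!]=\{1,2,\ldots\}$, $[\![?]\!]=\{0,1\}$, $[\![1]\!]=\{1\}$, $[\![0]\!]=\{0\}$. A disjunction-free multiplicity expression is $E=a_1^{M_1}\,\|\,\ldots\,\|\,a_k^{M_k}$, where the $a_i\in\Sigma$ are pairwise distinct symbols and the $M_i$ are multiplicities. Its language $L(E)$ is the set of unordered words $w$ such that $w(a_i)\in[\![M_i]\!]$ for all $1\le i\le k$ and $w(a)=0$ for every symbol $a$ not occurring in $E$. **Trees.** A tree $t=(N_t,\mathit{root}_t,\mathit{lab}_t,\mathit{child}_t)$ has a finite set of nodes $N_t$, a root $\mathit{root}_t\in N_t$, a labeling $\mathit{lab}_t:N_t\to\Sigma$, and an acyclic parent-child relation $\mathit{child}_t\subseteq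 N_t\times N_t$ in which every non-root node has exactly one predecessor. $\mathit{Tree}$ is the set of all finite trees; the size of a tree is its number of nodes. For $n\in N_t$, let $\mathit{ch}_t^n$ be the unordered word with $\mathit{ch}_t^n(a)=|\{m\in N_t\mid (n,m)\in\mathit{child}_t,\ \mathit{lab}_t(m)=a\}|$. **Schemas.** A disjunction-free multiplicity schema (MS) is a pair $S=(\mathit{root}_S,R_S)$ with $\mathit{root}_S\in\Sigma$ and $R_S$ mapping each symbol of $\Sigma$ to a disjunction-free multiplicity expression. A tree $t$ satisfies $S$ if $\mathit{lab}_t(\mathit{root}_t)=\mathit{root}_S$ and $\mathit{ch}_t^n\in L(R_S(\mathit{lab}_t(n)))$ for every $n\in N_t$. $L(S)$ is the set of all trees satisfying $S$. **Learnability.** A learning setting is a tuple $(\mathcal{E},\mathcal{C},\mathcal{L})$ with a set $\mathcal{E}$ of examples, a class $\mathcal{C}$ of concepts, and a function $\mathcal{L}$ mapping each concept to a subset of $\mathcal{E}$. A sample is a finite nonempty set $D\subseteq\mathcal{E}$ (its size is the sum of the sizes of its examples); it is consistent with $c\in\mathcal{C}$ if $D\subseteq\mathcal{L}(c)$. A learning algorithm takes a sample and returns a concept in $\mathcal{C}$ or a special value null. Concepts $c,c'$ are equivalent if $\mathcal{L}(c)=\mathcal{L}(c')$. The class $\mathcal{C}$ is learnable in polynomial time and data in $(\mathcal{E},\mathcal{C},\mathcal{L})$ if there is a learning algorithm $\mathit{learner}$, running in time polynomial in the size of its input, such that: (1) Soundness: for every sample $D$, $\mathit{learner}(D)$ returns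 a concept consistent with $D$, or null if no such concept exists; (2) Completeness: for every $c\in\mathcal{C}$ there is a sample $\mathit{CS}_c$, whose cardinality (number of examples) is polynomially bounded by the size of $c$, such that for every sample $D$ with $\mathit{CS}_c\subseteq D\subseteq\mathcal{L}(c)$, $\mathit{learner}(D)$ returns a concept equivalent to $c$. *)

theory Defs
  imports "HOL-Computational_Algebra.Polynomial"
begin

section \<open>Disjunction-free multiplicity expressions\<close>

type_synonym 'a uword = "'a \<Rightarrow> nat"

datatype mult = Star | Plus | Opt | One | Zero

fun mult_sem :: "mult \<Rightarrow> nat set" where
  "mult_sem Star = UNIV"
| "mult_sem Plus = {1..}"
| "mult_sem Opt = {0, 1}"
| "mult_sem One = {1}"
| "mult_sem Zero = {0}"

text \<open>The list \<open>[(a\<^sub>1, M\<^sub>1), \<dots>, (a\<^sub>k, M\<^sub>k)]\<close> stands for the expression with \<open>k \<ge> 0\<close>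
  factors; the empty list is the expression of the empty unordered word.\<close>

type_synonym 'a dme = "('a \<times> mult) list"

definition dmes :: "'a set \<Rightarrow> 'a dme set" where
  "dmes \<Sigma> = {E. distinct (map fst E) \<and> fst ` set E \<subseteq> \<Sigma>}"

definition dme_lang :: "'a dme \<Rightarrow> 'a uword set" where
  "dme_lang E = {w. (\<forall>(a, M) \<in> set E. w a \<in> mult_sem M) \<and> (\<forall>a. a \<notin> fst ` set E \<longrightarrow> w a = 0)}"


section \<open>Trees and schemas\<close>

record 'a tree =
  nodes :: "nat set"
  root_node :: nat
  lab :: "nat \<rightharpoonup> 'a"
  child :: "(nat \<times> nat) set"

text \<open>That the root has no predecessor and that every node is reachable from it
  follows from the conditions below.\<close>

definition trees :: "'a set \<Rightarrow> 'a tree set" where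
  "trees \<Sigma> = {t.
     finite (nodes t) \<and> root_node t \<in> nodes t \<and>
     dom (lab t) = nodes t \<and> ran (lab t) \<subseteq> \<Sigma> \<and>
     child t \<subseteq> nodes t \<times> nodes t \<and> acyclic (child t) \<and>
     (\<forall>n \<in> nodes t - {root_node t}. \<exists>!m. (m, n) \<in> child t)}"

definition tree_size :: "'a tree \<Rightarrow> nat" where
  "tree_size t = card (nodes t)"

definition label :: "'a tree \<Rightarrow> nat \<Rightarrow> 'a" where
  "label t n = the (lab t n)"

definition ch :: "'a tree \<Rightarrow> nat \<Rightarrow> 'a uword" where
  "ch t n = (\<lambda>a. card {m \<in> nodes t. (n, m) \<in> child t \<and> label t m = a})"

record 'a schema =
  root_sym :: 'a
  rule :: "'a \<rightharpoonup> 'a dme"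

definition MS :: "'a set \<Rightarrow> 'a schema set" where
  "MS \<Sigma> = {S. root_sym S \<in> \<Sigma> \<and> dom (rule S) = \<Sigma> \<and> ran (rule S) \<subseteq> dmes \<Sigma>}"

definition satisfies :: "'a tree \<Rightarrow> 'a schema \<Rightarrow> bool" where
  "satisfies t S \<longleftrightarrow>
     label t (root_node t) = root_sym S \<and>
     (\<forall>n \<in> nodes t. ch t n \<in> dme_lang (the (rule S (label t n))))"

definition schema_lang :: "'a set \<Rightarrow> 'a schema \<Rightarrow> 'a tree set" where
  "schema_lang \<Sigma> S = {t \<in> trees \<Sigma>. satisfies t S}"

definition schema_size :: "'a schema \<Rightarrow> nat" where
  "schema_size S = 1 + (\<Sum>a \<in> dom (rule S). 1 + length (the (rule S a)))"

datatype sign = Pos | Neg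

type_synonym 'a example = "'a tree \<times> sign"

definition trees_pm :: "'a set \<Rightarrow> 'a example set" where
  "trees_pm \<Sigma> = trees \<Sigma> \<times> UNIV"

definition schema_lang_pm :: "'a set \<Rightarrow> 'a schema \<Rightarrow> 'a example set" where
  "schema_lang_pm \<Sigma> S =
     {(t, Pos) | t. t \<in> schema_lang \<Sigma> S} \<union> {(t, Neg) | t. t \<in> trees \<Sigma> - schema_lang \<Sigma> S}"

definition example_size :: "'a example \<Rightarrow> nat" where
  "example_size e = tree_size (fst e)"


section \<open>Machine model\<close>

text \<open>
  Algorithms are programs of a first-order, call-by-value functional language, with de Bruijn
  indices for variables, over pairs and two sorts of atoms: alphabet symbols and node identifiers.
  Atoms can be tested for equality and symbols also for the order of the alphabet; programs contain
  no literal atoms and cannot inspect an atom in any other way. The cost of a run is the number of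
  constructs evaluated. With values shared as pointers every construct takes constant time
  for a fixed program (in particular, equality is not available on pairs), so this is the cost on a
  pointer machine with constant-time comparison of atoms.
\<close>

datatype 'a val = VNil | VPair "'a val" "'a val" | VSym 'a | VNode nat

datatype expr =
    EVar nat
  | ENil
  | EPair expr expr
  | EFst expr
  | ESnd expr
  | EEq expr expr
  | ELeq expr expr
  | EIf expr expr expr
  | ELet expr expr
  | ECall nat "expr list"

text \<open>The body of the \<open>i\<close>-th function is the \<open>i\<close>-th element; function \<open>0\<close> is the entry point.\<close>

type_synonym program = "expr list"

fun vfst :: "'a val \<Rightarrow> 'a val" where
  "vfst (VPair u v) = u"
| "vfst _ = VNil"

fun vsnd :: "'a val \<Rightarrow> 'a val" where
  "vsnd (VPair u v) = v"
| "vsnd _ = VNil"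

definition vbool :: "bool \<Rightarrow> 'a val" where
  "vbool b = (if b then VPair VNil VNil else VNil)"

fun veq :: "'a val \<Rightarrow> 'a val \<Rightarrow> bool" where
  "veq (VSym a) (VSym b) \<longleftrightarrow> a = b"
| "veq (VNode m) (VNode n) \<longleftrightarrow> m = n"
| "veq _ _ \<longleftrightarrow> False"

fun vleq :: "'a::linorder val \<Rightarrow> 'a val \<Rightarrow> bool" where
  "vleq (VSym a) (VSym b) \<longleftrightarrow> a \<le> b"
| "vleq _ _ \<longleftrightarrow> False"

text \<open>\<open>eval P \<rho> e v k\<close>: in environment \<open>\<rho>\<close>, the expression \<open>e\<close> evaluates to \<open>v\<close> at cost \<open>k\<close>.\<close>

inductive
  eval :: "program \<Rightarrow> 'a::linorder val list \<Rightarrow> expr \<Rightarrow> 'a val \<Rightarrow> nat \<Rightarrow> bool" and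
  evals :: "program \<Rightarrow> 'a::linorder val list \<Rightarrow> expr list \<Rightarrow> 'a val list \<Rightarrow> nat \<Rightarrow> bool"
  for P :: program
where
  EVar: "i < length \<rho> \<Longrightarrow> eval P \<rho> (EVar i) (\<rho> ! i) 1"
| ENil: "eval P \<rho> ENil VNil 1"
| EPair: "eval P \<rho> e1 v1 k1 \<Longrightarrow> eval P \<rho> e2 v2 k2 \<Longrightarrow>
    eval P \<rho> (EPair e1 e2) (VPair v1 v2) (1 + k1 + k2)"
| EFst: "eval P \<rho> e v k \<Longrightarrow> eval P \<rho> (EFst e) (vfst v) (1 + k)"
| ESnd: "eval P \<rho> e v k \<Longrightarrow> eval P \<rho> (ESnd e) (vsnd v) (1 + k)"
| EEq: "eval P \<rho> e1 v1 k1 \<Longrightarrow> eval P \<rho> e2 v2 k2 \<Longrightarrow>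
    eval P \<rho> (EEq e1 e2) (vbool (veq v1 v2)) (1 + k1 + k2)"
| ELeq: "eval P \<rho> e1 v1 k1 \<Longrightarrow> eval P \<rho> e2 v2 k2 \<Longrightarrow>
    eval P \<rho> (ELeq e1 e2) (vbool (vleq v1 v2)) (1 + k1 + k2)"
| EIf_True: "eval P \<rho> e v k \<Longrightarrow> v \<noteq> VNil \<Longrightarrow> eval P \<rho> e1 v1 k1 \<Longrightarrow>
    eval P \<rho> (EIf e e1 e2) v1 (1 + k + k1)"
| EIf_False: "eval P \<rho> e VNil k \<Longrightarrow> eval P \<rho> e2 v2 k2 \<Longrightarrow>
    eval P \<rho> (EIf e e1 e2) v2 (1 + k + k2)"
| ELet: "eval P \<rho> e1 v1 k1 \<Longrightarrow> eval P (v1 # \<rho>) e2 v2 k2 \<Longrightarrow>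
    eval P \<rho> (ELet e1 e2) v2 (1 + k1 + k2)"
| ECall: "evals P \<rho> es vs k \<Longrightarrow> f < length P \<Longrightarrow> eval P vs (P ! f) v k' \<Longrightarrow>
    eval P \<rho> (ECall f es) v (1 + k + k')"
| evals_Nil: "evals P \<rho> [] [] 0"
| evals_Cons: "eval P \<rho> e v k \<Longrightarrow> evals P \<rho> es vs k' \<Longrightarrow>
    evals P \<rho> (e # es) (v # vs) (k + k')"

inductive_cases eval_cases:
  "eval P \<rho> (EVar i) v k" "eval P \<rho> ENil v k" "eval P \<rho> (EPair e1 e2) v k"
  "eval P \<rho> (EFst e) v k" "eval P \<rho> (ESnd e) v k" "eval P \<rho> (EEq e1 e2) v k"
  "eval P \<rho> (ELeq e1 e2) v k" "eval P \<rho> (EIf e e1 e2) v k" "eval P \<rho> (ELet e1 e2) v k"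
  "eval P \<rho> (ECall f es) v k"
inductive_cases evals_cases: "evals P \<rho> [] vs k" "evals P \<rho> (e # es) vs k"

lemma eval_deterministic:
  "eval P \<rho> e v k \<Longrightarrow> eval P \<rho> e v' k' \<Longrightarrow> v' = v \<and> k' = k"
  "evals P \<rho> es vs l \<Longrightarrow> evals P \<rho> es vs' l' \<Longrightarrow> vs' = vs \<and> l' = l"
  apply (induction arbitrary: v' k' and vs' l' rule: eval_evals.inducts)
  subgoal by (erule eval_cases) simp
  subgoal by (erule eval_cases) simp
  subgoal premises p for \<rho> e1 v1 k1 e2 v2 k2 v' k'
    using p(5) by (rule eval_cases(3)) (use p(2,4) in auto)
  subgoal premises p for \<rho> e v k v' k' using p(3) by (rule eval_cases(4)) (use p(2) in auto)
  subgoal premises p for \<rho> e v k v' k' using p(3) by (rule eval_cases(5)) (use p(2) in auto)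
  subgoal premises p for \<rho> e1 v1 k1 e2 v2 k2 v' k'
    using p(5) by (rule eval_cases(6)) (use p(2,4) in auto)
  subgoal premises p for \<rho> e1 v1 k1 e2 v2 k2 v' k'
    using p(5) by (rule eval_cases(7)) (use p(2,4) in auto)
  subgoal premises p for \<rho> e v k e1 v1 k1 e2 v' k'
    using p(6) by (rule eval_cases(8)) (use p(2,3,5) in auto)
  subgoal premises p for \<rho> e k e2 v2 k2 e1 v' k'
    using p(5) by (rule eval_cases(8)) (use p(2,4) in auto)
  subgoal premises p for \<rho> e1 v1 k1 e2 v2 k2 v' k'
    using p(5) by (rule eval_cases(9)) (use p(2,4) in auto)
  subgoal premises p for \<rho> es vs k f v k' v' k''
    using p(6) by (rule eval_cases(10)) (use p(2,5) in auto)
  subgoal by (erule evals_cases) simp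
  subgoal premises p for \<rho> e v k es vs k' vs' l'
    using p(5) by (rule evals_cases(2)) (use p(2,4) in auto)
  done

definition runs :: "program \<Rightarrow> 'a::linorder val list \<Rightarrow> 'a val \<Rightarrow> nat \<Rightarrow> bool" where
  "runs P vs v k \<longleftrightarrow> P \<noteq> [] \<and> eval P vs (P ! 0) v k"


section \<open>Representation of the data\<close>

text \<open>A finite set is represented by any repetition-free list of its elements, so a set (and likewise
  a tree) has many representations.\<close>

fun vlist :: "'a val list \<Rightarrow> 'a val" where
  "vlist [] = VNil"
| "vlist (v # vs) = VPair v (vlist vs)"

definition rep_set :: "('b \<Rightarrow> 'a val \<Rightarrow> bool) \<Rightarrow> 'b set \<Rightarrow> 'a val \<Rightarrow> bool" where
  "rep_set rep X v \<longleftrightarrow>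
     (\<exists>xs vs. distinct xs \<and> set xs = X \<and> list_all2 rep xs vs \<and> v = vlist vs)"

definition rep_sym :: "'a \<Rightarrow> 'a val \<Rightarrow> bool" where
  "rep_sym a v \<longleftrightarrow> v = VSym a"

fun rep_option :: "('b \<Rightarrow> 'a val \<Rightarrow> bool) \<Rightarrow> 'b option \<Rightarrow> 'a val \<Rightarrow> bool" where
  "rep_option rep None v \<longleftrightarrow> v = VNil"
| "rep_option rep (Some x) v \<longleftrightarrow> (\<exists>u. rep x u \<and> v = VPair u VNil)"

text \<open>A tree is given by its root, its labeled nodes and its edges.\<close>

definition rep_tree :: "'a tree \<Rightarrow> 'a val \<Rightarrow> bool" where
  "rep_tree t v \<longleftrightarrow> (\<exists>ns es.
     rep_set (\<lambda>n u. u = VPair (VNode n) (VSym (label t n))) (nodes t) ns \<and>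
     rep_set (\<lambda>(m, n) u. u = VPair (VNode m) (VNode n)) (child t) es \<and>
     v = VPair (VNode (root_node t)) (VPair ns es))"

definition rep_example :: "'a example \<Rightarrow> 'a val \<Rightarrow> bool" where
  "rep_example e v \<longleftrightarrow> (\<exists>u. rep_tree (fst e) u \<and> v = VPair (vbool (snd e = Pos)) u)"

fun vmult :: "mult \<Rightarrow> 'a val" where
  "vmult Star = vlist []"
| "vmult Plus = vlist [VNil]"
| "vmult Opt = vlist [VNil, VNil]"
| "vmult One = vlist [VNil, VNil, VNil]"
| "vmult Zero = vlist [VNil, VNil, VNil, VNil]"

definition vdme :: "'a dme \<Rightarrow> 'a val" where
  "vdme E = vlist (map (\<lambda>(a, M). VPair (VSym a) (vmult M)) E)"

definition rep_schema :: "'a schema \<Rightarrow> 'a val \<Rightarrow> bool" where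
  "rep_schema S v \<longleftrightarrow> (\<exists>rs.
     rep_set (\<lambda>a u. u = VPair (VSym a) (vdme (the (rule S a)))) (dom (rule S)) rs \<and>
     v = VPair (VSym (root_sym S)) rs)"


section \<open>Learnability\<close>

text \<open>A learning setting is a family of tuples \<open>(\<E> \<Sigma>, \<C> \<Sigma>, \<L> \<Sigma>)\<close> indexed by the
  finite alphabet \<open>\<Sigma>\<close>.\<close>

definition sample :: "'e set \<Rightarrow> 'e set \<Rightarrow> bool" where
  "sample Es D \<longleftrightarrow> finite D \<and> D \<noteq> {} \<and> D \<subseteq> Es"

definition sound_learner ::
  "'e set \<Rightarrow> 'c set \<Rightarrow> ('c \<Rightarrow> 'e set) \<Rightarrow> ('e set \<Rightarrow> 'c option) \<Rightarrow> bool" where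
  "sound_learner Es Cs L learner \<longleftrightarrow>
     (\<forall>D. sample Es D \<longrightarrow>
        (case learner D of
           Some c \<Rightarrow> c \<in> Cs \<and> D \<subseteq> L c
         | None \<Rightarrow> \<not> (\<exists>c \<in> Cs. D \<subseteq> L c)))"

definition complete_learner ::
  "'e set \<Rightarrow> 'c set \<Rightarrow> ('c \<Rightarrow> 'e set) \<Rightarrow> ('c \<Rightarrow> nat) \<Rightarrow> nat poly \<Rightarrow> ('e set \<Rightarrow> 'c option) \<Rightarrow> bool" where
  "complete_learner Es Cs L csize q learner \<longleftrightarrow>
     (\<forall>c \<in> Cs. \<exists>CS. sample Es CS \<and> CS \<subseteq> L c \<and> card CS \<le> poly q (csize c) \<and>
        (\<forall>D. sample Es D \<and> CS \<subseteq> D \<and> D \<subseteq> L c \<longrightarrow>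
           (\<exists>c' \<in> Cs. learner D = Some c' \<and> L c' = L c)))"

text \<open>On every representation of the input \<open>(\<Sigma>, D)\<close>, whose size is the cardinality of \<open>\<Sigma>\<close> plus the
  sum of the sizes of the examples, the program returns a representation of the result.\<close>

definition computes_within ::
  "program \<Rightarrow> nat poly \<Rightarrow> ('e \<Rightarrow> nat) \<Rightarrow> ('e \<Rightarrow> 'a::linorder val \<Rightarrow> bool) \<Rightarrow> ('c \<Rightarrow> 'a val \<Rightarrow> bool) \<Rightarrow>
   'a set \<Rightarrow> 'e set \<Rightarrow> ('e set \<Rightarrow> 'c option) \<Rightarrow> bool" where
  "computes_within P p esize erep crep \<Sigma> Es learner \<longleftrightarrow>
     (\<forall>D vA vD. sample Es D \<and> rep_set rep_sym \<Sigma> vA \<and> rep_set erep D vD \<longrightarrow>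
        (\<exists>v k. runs P [vA, vD] v k \<and> rep_option crep (learner D) v \<and>
               k \<le> poly p (card \<Sigma> + (\<Sum>e \<in> D. esize e))))"

text \<open>The program \<open>P\<close> and the polynomials \<open>p\<close> and \<open>q\<close> are uniform in \<open>\<Sigma>\<close>.\<close>

definition learnable_ptd ::
  "('a::linorder set \<Rightarrow> 'e set) \<Rightarrow> ('a set \<Rightarrow> 'c set) \<Rightarrow> ('a set \<Rightarrow> 'c \<Rightarrow> 'e set) \<Rightarrow>
   ('e \<Rightarrow> nat) \<Rightarrow> ('c \<Rightarrow> nat) \<Rightarrow> ('e \<Rightarrow> 'a val \<Rightarrow> bool) \<Rightarrow> ('c \<Rightarrow> 'a val \<Rightarrow> bool) \<Rightarrow> bool" where
  "learnable_ptd \<E> \<C> \<L> esize csize erep crep \<longleftrightarrow>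
     (\<exists>(P :: program) (p :: nat poly) (q :: nat poly).
        \<forall>\<Sigma>. finite \<Sigma> \<longrightarrow>
          (\<exists>learner :: 'e set \<Rightarrow> 'c option.
             computes_within P p esize erep crep \<Sigma> (\<E> \<Sigma>) learner \<and>
             sound_learner (\<E> \<Sigma>) (\<C> \<Sigma>) (\<L> \<Sigma>) learner \<and>
             complete_learner (\<E> \<Sigma>) (\<C> \<Sigma>) (\<L> \<Sigma>) csize q learner))"

end

theory Submission
  imports Defs
begin

text \<open>The learner returns the schema that assigns to each pair \<open>(a, b)\<close> of symbols the least
  multiplicity containing all numbers of \<open>b\<close>-children of \<open>a\<close>-nodes in the positive examples. Its
  language is the least one of a schema that contains the positive examples, so if any schema is
  consistent with the negative examples, this one is. The least multiplicity depends only on whether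
  the numbers 0, 1, and at least 2 have been observed, hence three positive witnesses for each pair
  \<open>(a, b)\<close> determine the schema, and negative examples are not needed. Without positive examples the
  learner returns a schema with the empty language.\<close>

text \<open>The program reads some listing of the alphabet and of the sample, whereas the learner is
  a function of the sets. The rules of a represented schema may come in any order, but an expression
  is a list, so its factors need an order that does not depend on the listing; this is why the
  program sorts. The root symbol is the other choice: two positive examples with different root
  labels exclude every schema, so the final consistency check makes the result independent of the
  label taken. The running time is estimated coarsely. One number bounds the lengths of all lists,
  every level of nested loops costs one more power of it, and therefore fits can be recomputed
  wherever they are needed.\<close>

section \<open>Trees: basic facts, induction from the root, leaves\<close>

lemma label_in_alphabet: "t \<in> trees \<Sigma> \<Longrightarrow> n \<in> nodes t \<Longrightarrow> label t n \<in> \<Sigma>"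
  unfolding trees_def label_def ran_def by (smt (verit) domD mem_Collect_eq option.sel subsetD)

lemma finite_nodes: "t \<in> trees \<Sigma> \<Longrightarrow> finite (nodes t)"
  by (simp add: trees_def)

lemma root_in_nodes: "t \<in> trees \<Sigma> \<Longrightarrow> root_node t \<in> nodes t"
  by (simp add: trees_def)

lemma ch_pos_iff:
  assumes "t \<in> trees \<Sigma>"
  shows "0 < ch t n b \<longleftrightarrow> (\<exists>m \<in> nodes t. (n, m) \<in> child t \<and> label t m = b)"
proof -
  have "finite {m \<in> nodes t. (n, m) \<in> child t \<and> label t m = b}"
    using finite_nodes[OF assms] by simp
  then show ?thesis by (auto simp: ch_def card_gt_0_iff)
qed

lemma ch_outside_alphabet: "t \<in> trees \<Sigma> \<Longrightarrow> b \<notin> \<Sigma> \<Longrightarrow> ch t n b = 0"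
  using ch_pos_iff[of t \<Sigma> n b] label_in_alphabet[of t \<Sigma>] by fastforce

lemma root_label_in_alphabet: "t \<in> trees \<Sigma> \<Longrightarrow> label t (root_node t) \<in> \<Sigma>"
  by (simp add: label_in_alphabet root_in_nodes)

lemma finite_child: "t \<in> trees \<Sigma> \<Longrightarrow> finite (child t)"
  by (auto simp: trees_def intro: finite_subset)

text \<open>Supplies reachability from the root, which \<open>trees\<close> does not state: a finite
  acyclic relation is well-founded, and a non-root node has a parent that is again a node.\<close>

lemma tree_induct [consumes 2, case_names root child]:
  assumes t: "t \<in> trees \<Sigma>" and n: "n \<in> nodes t"
    and root: "Q (root_node t)"
    and step: "\<And>m n. (m, n) \<in> child t \<Longrightarrow> m \<in> nodes t \<Longrightarrow> n \<in> nodes t \<Longrightarrow> Q m \<Longrightarrow> Q n"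
  shows "Q n"
proof -
  have "wf (child t)"
    using t finite_child[OF t] by (auto simp: trees_def intro: finite_acyclic_wf)
  then show ?thesis using n
  proof (induction n rule: wf_induct_rule)
    case (less n)
    show ?case
    proof (cases "n = root_node t")
      case False
      with t less.prems have "\<exists>!m. (m, n) \<in> child t" by (simp add: trees_def)
      then obtain m where m: "(m, n) \<in> child t" by blast
      then have "m \<in> nodes t" using t by (auto simp: trees_def)
      with m less show ?thesis by (blast intro: step)
    qed (simp add: root)
  qed
qed

text \<open>The converse of a finite acyclic relation is well-founded too, and a node minimal for it
  has no children. This refutes schemas that demand a child at every node.\<close>

lemma tree_has_leaf:
  assumes t: "t \<in> trees \<Sigma>"
  obtains n where "n \<in> nodes t" "\<forall>b. ch t n b = 0"
proof -
  have "wf ((child t)\<inverse>)"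
    using t finite_child[OF t] by (auto simp: trees_def intro: finite_acyclic_wf_converse)
  then obtain n where "n \<in> nodes t" "\<And>m. (m, n) \<in> (child t)\<inverse> \<Longrightarrow> m \<notin> nodes t"
    using root_in_nodes[OF t] by (metis wfE_min)
  then show ?thesis using that ch_pos_iff[OF t, of n] by (metis converse_iff gr0I)
qed

lemma single_node_tree:
  assumes "a \<in> \<Sigma>"
  shows "\<lparr>nodes = {0}, root_node = 0, lab = [0 \<mapsto> a], child = {}\<rparr> \<in> trees \<Sigma>"
  using assms by (auto simp: trees_def acyclic_def)

definition dme_mult :: "'a dme \<Rightarrow> 'a \<Rightarrow> mult" where
  "dme_mult E b = (case map_of E b of None \<Rightarrow> Zero | Some M \<Rightarrow> M)"

text \<open>Reading a missing symbol as \<open>Zero\<close> turns membership into a separate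
  condition at each symbol, so that fits can be compared symbol by symbol. Distinctness lets
  \<open>map_of\<close> see every factor.\<close>

lemma dme_lang_iff:
  assumes "E \<in> dmes \<Sigma>"
  shows "w \<in> dme_lang E \<longleftrightarrow> (\<forall>b. w b \<in> mult_sem (dme_mult E b))"
proof -
  have d: "distinct (map fst E)" using assms by (simp add: dmes_def)
  show ?thesis
  proof
    assume w: "w \<in> dme_lang E"
    show "\<forall>b. w b \<in> mult_sem (dme_mult E b)"
    proof
      fix b
      show "w b \<in> mult_sem (dme_mult E b)"
      proof (cases "map_of E b")
        case None
        then have "b \<notin> fst ` set E" by (simp add: map_of_eq_None_iff)
        then show ?thesis using w None by (simp add: dme_lang_def dme_mult_def)
      next
        case (Some M)
        then show ?thesis using w by (auto simp: dme_lang_def dme_mult_def dest!: map_of_SomeD)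
      qed
    qed
  next
    assume h: "\<forall>b. w b \<in> mult_sem (dme_mult E b)"
    have "w b \<in> mult_sem M" if "(b, M) \<in> set E" for b M
      using h[rule_format, of b] map_of_is_SomeI[OF d that] by (simp add: dme_mult_def)
    moreover have "w b = 0" if "b \<notin> fst ` set E" for b
    proof -
      have "map_of E b = None" using that by (simp add: map_of_eq_None_iff)
      then show ?thesis using h[rule_format, of b] by (simp add: dme_mult_def)
    qed
    ultimately show "w \<in> dme_lang E" by (auto simp: dme_lang_def)
  qed
qed

section \<open>Minimal fits\<close>

text \<open>The five multiplicities are closed under intersections that contain a given nonempty set, and
  the least one containing it depends only on whether it has the elements 0, 1, or some larger one.
  The choice \<open>fit {} = One\<close> makes a schema without positive examples unsatisfiable.\<close>

definition fit :: "nat set \<Rightarrow> mult" where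
  "fit X = (if \<exists>k \<in> X. 2 \<le> k then if 0 \<in> X then Star else Plus
            else if 0 \<in> X then if 1 \<in> X then Opt else Zero else One)"

lemma fit_contains: "X \<subseteq> mult_sem (fit X)"
proof
  fix k assume "k \<in> X"
  then show "k \<in> mult_sem (fit X)"
    by (cases "k = 0 \<or> k = 1") (auto simp: fit_def intro!: bexI[of _ k])
qed

text \<open>Only \<open>Star\<close> and \<open>Plus\<close> contain a number above 1, so one such
  number forces all of \<open>{1..}\<close>, and together with 0 it forces \<open>Star\<close>. The
  set must be nonempty because \<open>fit {}\<close> is a convention, not a least value.\<close>

lemma fit_least:
  assumes "X \<noteq> {}" "X \<subseteq> mult_sem M"
  shows "mult_sem (fit X) \<subseteq> mult_sem M"
proof -
  obtain x where "x \<in> X" using assms(1) by blast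
  then have "0 \<in> X \<or> 1 \<in> X \<or> (\<exists>k \<in> X. 2 \<le> k)" by (metis One_nat_def less_2_cases not_le)
  moreover have "0 \<in> mult_sem M" if "0 \<in> X" using that assms(2) by blast
  moreover have "1 \<in> mult_sem M" if "1 \<in> X" using that assms(2) by blast
  moreover have "{1..} \<subseteq> mult_sem M" if "\<exists>k \<in> X. 2 \<le> k"
    using that assms(2) by (cases M) auto
  moreover have "mult_sem M = UNIV" if "\<exists>k \<in> X. 2 \<le> k" "0 \<in> X"
    using that assms(2) by (cases M) auto
  ultimately show ?thesis unfolding fit_def by auto
qed

text \<open>Expresses membership by the three flags, in the form in which
  \<open>symbol_ok_step\<close> tests it. The number 1 is missing from \<open>Zero\<close>
  only.\<close>

lemma mem_fit_iff:
  "k \<in> mult_sem (fit X) \<longleftrightarrow>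
     (if k = 0 then 0 \<in> X
      else if k = 1 then 0 \<notin> X \<or> 1 \<in> X \<or> (\<exists>k \<in> X. 2 \<le> k)
      else \<exists>k \<in> X. 2 \<le> k)"
  by (auto simp: fit_def)

section \<open>The candidate schema and soundness of the learner\<close>

definition obs :: "'a example set \<Rightarrow> 'a \<Rightarrow> 'a \<Rightarrow> nat set" where
  "obs D a b = {ch t n b | t n. (t, Pos) \<in> D \<and> n \<in> nodes t \<and> label t n = a}"

definition pos_roots :: "'a example set \<Rightarrow> 'a set" where
  "pos_roots D = {label t (root_node t) | t. (t, Pos) \<in> D}"

text \<open>The factors are sorted so that the expression depends on the sets alone; the program can
  reproduce this order.\<close>

definition candidate :: "'a::linorder set \<Rightarrow> 'a example set \<Rightarrow> 'a \<Rightarrow> 'a schema" where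
  "candidate \<Sigma> D r = \<lparr>root_sym = r, rule = (\<lambda>a. if a \<in> \<Sigma>
     then Some (map (\<lambda>b. (b, fit (obs D a b))) (sorted_list_of_set \<Sigma>)) else None)\<rparr>"

text \<open>\<open>Min \<Sigma>\<close> is a default that the program finds at the head of the
  sorted alphabet. When \<open>pos_roots D\<close> has several elements, no schema is consistent and
  the check fails for each of them.\<close>

definition learner :: "'a::linorder set \<Rightarrow> 'a example set \<Rightarrow> 'a schema option" where
  "learner \<Sigma> D =
     (let S = candidate \<Sigma> D (if pos_roots D = {} then Min \<Sigma> else SOME r. r \<in> pos_roots D)
      in if D \<subseteq> schema_lang_pm \<Sigma> S then Some S else None)"

lemma candidate_in_MS: "finite \<Sigma> \<Longrightarrow> r \<in> \<Sigma> \<Longrightarrow> candidate \<Sigma> D r \<in> MS \<Sigma>"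
  by (auto simp: MS_def candidate_def dmes_def ran_def dom_def o_def split: if_splits)

lemma satisfies_candidate_iff:
  assumes "finite \<Sigma>" "t \<in> trees \<Sigma>"
  shows "satisfies t (candidate \<Sigma> D r) \<longleftrightarrow> label t (root_node t) = r \<and>
    (\<forall>n \<in> nodes t. \<forall>b \<in> \<Sigma>. ch t n b \<in> mult_sem (fit (obs D (label t n) b)))"
proof -
  have "ch t n \<in> dme_lang (the (rule (candidate \<Sigma> D r) (label t n))) \<longleftrightarrow>
      (\<forall>b \<in> \<Sigma>. ch t n b \<in> mult_sem (fit (obs D (label t n) b)))" if "n \<in> nodes t" for n
    using assms label_in_alphabet[OF assms(2) that] ch_outside_alphabet[OF assms(2)]
    by (simp add: candidate_def dme_lang_def image_image)
  then show ?thesis by (simp add: satisfies_def candidate_def)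
qed

lemma satisfies_iff:
  assumes "S \<in> MS \<Sigma>" "t \<in> trees \<Sigma>"
  shows "satisfies t S \<longleftrightarrow> label t (root_node t) = root_sym S \<and>
    (\<forall>n \<in> nodes t. \<forall>b. ch t n b \<in> mult_sem (dme_mult (the (rule S (label t n))) b))"
proof -
  have "the (rule S (label t n)) \<in> dmes \<Sigma>" if "n \<in> nodes t" for n
    using assms(1) label_in_alphabet[OF assms(2) that] by (force simp: MS_def dom_def ran_def)
  then show ?thesis by (simp add: satisfies_def dme_lang_iff[of _ \<Sigma>])
qed

lemma schema_lang_pm_Pos: "(t, Pos) \<in> schema_lang_pm \<Sigma> S \<longleftrightarrow> t \<in> trees \<Sigma> \<and> satisfies t S"
  and schema_lang_pm_Neg: "(t, Neg) \<in> schema_lang_pm \<Sigma> S \<longleftrightarrow> t \<in> trees \<Sigma> \<and> \<not> satisfies t S"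
  by (auto simp: schema_lang_pm_def schema_lang_def)

lemma satisfies_candidate_Pos:
  assumes "finite \<Sigma>" "t \<in> trees \<Sigma>" "(t, Pos) \<in> D"
  shows "satisfies t (candidate \<Sigma> D (label t (root_node t)))"
  unfolding satisfies_candidate_iff[OF assms(1,2)]
  using assms(3) fit_contains by (fastforce simp: obs_def)

text \<open>Below a root label of a positive example only labels of positive examples can be generated,
  so the fits at the other symbols do not matter.\<close>

lemma candidate_least:
  assumes fin: "finite \<Sigma>" and S: "S \<in> MS \<Sigma>" and D: "D \<subseteq> schema_lang_pm \<Sigma> S"
    and r: "r \<in> pos_roots D"
    and t: "t \<in> trees \<Sigma>" and sat: "satisfies t (candidate \<Sigma> D r)"
  shows "satisfies t S"
proof -
  \<comment> \<open>For a label in \<open>seen\<close> every set \<open>obs D a b\<close> is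
    nonempty, so that \<open>fit_least\<close> applies.\<close>
  define seen where "seen = {label u n | u n. (u, Pos) \<in> D \<and> n \<in> nodes u}"
  have pos: "u \<in> trees \<Sigma>" "satisfies u S" if "(u, Pos) \<in> D" for u
    using D that schema_lang_pm_Pos by blast+
  have root: "label t (root_node t) = r"
    and cand: "\<And>n b. n \<in> nodes t \<Longrightarrow> b \<in> \<Sigma> \<Longrightarrow> ch t n b \<in> mult_sem (fit (obs D (label t n) b))"
    using sat by (auto simp: satisfies_candidate_iff[OF fin t])
  obtain u0 where u0: "(u0, Pos) \<in> D" "label u0 (root_node u0) = r"
    using r by (auto simp: pos_roots_def)
  have obs_ne: "obs D a b \<noteq> {}" if "a \<in> seen" for a b
    using that unfolding seen_def obs_def by blast
  have seen: "label t n \<in> seen" if "n \<in> nodes t" for n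
    using t that
  proof (induction n rule: tree_induct)
    case root
    then show ?case
      using u0 root_in_nodes[OF pos(1)[OF u0(1)]] \<open>label t (root_node t) = r\<close>
      by (auto simp: seen_def)
  next
    case (child m n)
    let ?b = "label t n"
    have pos_ch: "0 < ch t m ?b" unfolding ch_pos_iff[OF t] using child by blast
    have mem: "ch t m ?b \<in> mult_sem (fit (obs D (label t m) ?b))"
      using child(2,3) by (intro cand label_in_alphabet[OF t])
    \<comment> \<open>If only 0 had been observed, the fit would lie within \<open>Zero\<close> and
      forbid the child \<open>n\<close>. Hence some positive example has a child with this label,
      and the label is seen.\<close>
    have "\<not> obs D (label t m) ?b \<subseteq> {0}"
    proof
      assume "obs D (label t m) ?b \<subseteq> {0}"
      then have "mult_sem (fit (obs D (label t m) ?b)) \<subseteq> {0}"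
        using fit_least[OF obs_ne[OF child(4)], of ?b Zero] by simp
      with mem pos_ch show False by auto
    qed
    then obtain u k where u: "(u, Pos) \<in> D" "0 < ch u k ?b" by (auto simp: obs_def)
    from u(2) obtain m' where "m' \<in> nodes u" "label u m' = ?b"
      unfolding ch_pos_iff[OF pos(1)[OF u(1)]] by blast
    with u(1) have "\<exists>u n'. ?b = label u n' \<and> (u, Pos) \<in> D \<and> n' \<in> nodes u"
      by (intro exI[of _ u] exI[of _ m']) simp
    then show ?case unfolding seen_def by (rule CollectI)
  qed
  have "ch t n b \<in> mult_sem (dme_mult (the (rule S (label t n))) b)" if n: "n \<in> nodes t" for n b
  proof -
    have "obs D (label t n) b \<noteq> {}" using seen[OF n] obs_ne by blast
    moreover have sub: "obs D (label t n) b \<subseteq> mult_sem (dme_mult (the (rule S (label t n))) b)"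
    proof
      fix k assume "k \<in> obs D (label t n) b"
      then obtain u m where u: "(u, Pos) \<in> D" "m \<in> nodes u" "label u m = label t n" "k = ch u m b"
        unfolding obs_def by blast
      from pos[OF u(1)] u(2) have "ch u m b \<in> mult_sem (dme_mult (the (rule S (label u m))) b)"
        by (simp add: satisfies_iff[OF S])
      then show "k \<in> mult_sem (dme_mult (the (rule S (label t n))) b)" by (simp add: u)
    qed
    ultimately have least: "mult_sem (fit (obs D (label t n) b)) \<subseteq>
      mult_sem (dme_mult (the (rule S (label t n))) b)" by (rule fit_least)
    show ?thesis
    proof (cases "b \<in> \<Sigma>")
      case True
      then show ?thesis using least cand[OF n] by blast
    next
      \<comment> \<open>The fits range over \<Sigma> only. Outside it the counts are 0 in every
        tree, and \<open>S\<close> permits 0 because it was observed.\<close>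
      case False
      then have "ch u k b = 0" if "(u, Pos) \<in> D" for u k
        using ch_outside_alphabet[OF pos(1)[OF that]] by blast
      then have "obs D (label t n) b \<subseteq> {0}" unfolding obs_def by (auto simp del: ex_simps)
      then have "0 \<in> obs D (label t n) b" using \<open>obs D (label t n) b \<noteq> {}\<close> by blast
      then show ?thesis using sub ch_outside_alphabet[OF t False] by auto
    qed
  qed
  moreover have "label t (root_node t) = root_sym S"
    using root u0 satisfies_iff[OF S pos(1)[OF u0(1)]] pos(2)[OF u0(1)] by simp
  ultimately show ?thesis by (simp add: satisfies_iff[OF S t])
qed

text \<open>Every fit is \<open>fit {}\<close>, that is \<open>One\<close>, so each node needs a
  child of every symbol, which a leaf lacks. The label of the leaf merely provides an element of
  \<Sigma>.\<close>

lemma candidate_unsatisfiable: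
  assumes fin: "finite \<Sigma>" and none: "pos_roots D = {}" and t: "t \<in> trees \<Sigma>"
  shows "\<not> satisfies t (candidate \<Sigma> D r)"
proof
  assume "satisfies t (candidate \<Sigma> D r)"
  moreover obtain n where n: "n \<in> nodes t" "\<forall>b. ch t n b = 0" using tree_has_leaf[OF t] .
  moreover have "label t n \<in> \<Sigma>" using label_in_alphabet t n(1) .
  ultimately have "0 \<in> mult_sem (fit (obs D (label t n) (label t n)))"
    using satisfies_candidate_iff[OF fin t] by metis
  moreover have "obs D (label t n) (label t n) = {}"
    using none by (auto simp: obs_def pos_roots_def)
  ultimately show False by (simp add: fit_def)
qed

lemma pos_roots_unique: "D \<subseteq> schema_lang_pm \<Sigma> S \<Longrightarrow> r \<in> pos_roots D \<Longrightarrow> r = root_sym S"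
  using schema_lang_pm_Pos[of _ \<Sigma> S] unfolding pos_roots_def satisfies_def by blast

text \<open>Positive examples are accepted by construction of the fits. The candidate accepts no
  tree that \<open>S\<close> rejects, so negative examples stay rejected.\<close>

lemma consistent_candidate:
  assumes fin: "finite \<Sigma>" and S: "S \<in> MS \<Sigma>" and D: "D \<subseteq> schema_lang_pm \<Sigma> S"
    and r: "pos_roots D = {} \<or> r \<in> pos_roots D"
  shows "D \<subseteq> schema_lang_pm \<Sigma> (candidate \<Sigma> D r)"
proof
  fix e assume e: "e \<in> D"
  obtain t s where [simp]: "e = (t, s)" by (cases e)
  show "e \<in> schema_lang_pm \<Sigma> (candidate \<Sigma> D r)"
  proof (cases s)
    case Pos
    then have t: "t \<in> trees \<Sigma>" using D e schema_lang_pm_Pos by auto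
    have root: "label t (root_node t) \<in> pos_roots D" using e Pos by (auto simp: pos_roots_def)
    then have "label t (root_node t) = r" using r pos_roots_unique[OF D] by auto
    then show ?thesis using satisfies_candidate_Pos[OF fin t] e Pos t
      by (auto simp: schema_lang_pm_Pos)
  next
    case Neg
    then have t: "t \<in> trees \<Sigma>" "\<not> satisfies t S" using D e schema_lang_pm_Neg by auto
    then have "\<not> satisfies t (candidate \<Sigma> D r)"
      using r candidate_unsatisfiable[OF fin] candidate_least[OF fin S D] by blast
    then show ?thesis using Neg t by (simp add: schema_lang_pm_Neg)
  qed
qed

text \<open>A sample is nonempty and its trees have labeled roots, so \<Sigma> is nonempty and
  \<open>Min \<Sigma>\<close> is meaningful.\<close>

lemma root_choice_in_alphabet:
  assumes "finite \<Sigma>" "sample (trees_pm \<Sigma>) D" "r \<in> pos_roots D \<or> r = Min \<Sigma>"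
  shows "r \<in> \<Sigma>"
proof -
  have D: "t \<in> trees \<Sigma>" if "(t, s) \<in> D" for t s
    using assms(2) that by (auto simp: sample_def trees_pm_def)
  obtain t s where "(t, s) \<in> D" using assms(2) by (auto simp: sample_def)
  then have "\<Sigma> \<noteq> {}" using D root_label_in_alphabet by blast
  then have "Min \<Sigma> \<in> \<Sigma>" using assms(1) by simp
  moreover have "pos_roots D \<subseteq> \<Sigma>"
    using D root_label_in_alphabet unfolding pos_roots_def by blast
  ultimately show ?thesis using assms(3) by blast
qed

text \<open>Replaces the \<open>SOME\<close> in the learner by any admissible root, such as the one
  the program meets first. If the two roots differ, neither candidate is consistent, and both sides
  are \<open>None\<close>.\<close>

lemma learner_eqI:
  assumes "finite \<Sigma>" "sample (trees_pm \<Sigma>) D"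
    and r: "if pos_roots D = {} then r = Min \<Sigma> else r \<in> pos_roots D"
  shows "learner \<Sigma> D =
    (if D \<subseteq> schema_lang_pm \<Sigma> (candidate \<Sigma> D r) then Some (candidate \<Sigma> D r) else None)"
proof (cases "pos_roots D = {}")
  case True
  then show ?thesis using r by (simp add: learner_def)
next
  case False
  define r' where "r' = (SOME r. r \<in> pos_roots D)"
  have r': "r' \<in> pos_roots D" unfolding r'_def using False by (simp add: some_in_eq)
  have L: "learner \<Sigma> D =
    (if D \<subseteq> schema_lang_pm \<Sigma> (candidate \<Sigma> D r') then Some (candidate \<Sigma> D r') else None)"
    using False by (simp add: learner_def r'_def Let_def)
  have "r = r'" if "D \<subseteq> schema_lang_pm \<Sigma> S" for S
    using pos_roots_unique[OF that] r r' False by metis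
  then show ?thesis unfolding L by auto
qed

lemma sound_learner_learner:
  assumes fin: "finite \<Sigma>"
  shows "sound_learner (trees_pm \<Sigma>) (MS \<Sigma>) (schema_lang_pm \<Sigma>) (learner \<Sigma>)"
  unfolding sound_learner_def
proof (intro allI impI)
  fix D assume D: "sample (trees_pm \<Sigma>) D"
  define r where "r = (if pos_roots D = {} then Min \<Sigma> else SOME r. r \<in> pos_roots D)"
  have r: "if pos_roots D = {} then r = Min \<Sigma> else r \<in> pos_roots D"
    by (simp add: r_def some_in_eq)
  then have "r \<in> \<Sigma>" using root_choice_in_alphabet[OF fin D] by metis
  then show "case learner \<Sigma> D of None \<Rightarrow> \<not> (\<exists>c \<in> MS \<Sigma>. D \<subseteq> schema_lang_pm \<Sigma> c)
      | Some c \<Rightarrow> c \<in> MS \<Sigma> \<and> D \<subseteq> schema_lang_pm \<Sigma> c"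
    using consistent_candidate[OF fin, of _ D r] r candidate_in_MS[OF fin]
    unfolding learner_eqI[OF fin D r] by (auto split: if_splits)
qed

section \<open>Characteristic samples\<close>

text \<open>Here 2 stands for all numbers above 1, the precision at which \<open>fit\<close> sees a
  set.\<close>

definition cap2 :: "nat \<Rightarrow> nat" where "cap2 k = min k 2"

lemma mem_cap2_image:
  "0 \<in> cap2 ` X \<longleftrightarrow> 0 \<in> X" "1 \<in> cap2 ` X \<longleftrightarrow> 1 \<in> X" "2 \<in> cap2 ` X \<longleftrightarrow> (\<exists>k \<in> X. 2 \<le> k)"
proof -
  have "0 = cap2 k \<longleftrightarrow> k = 0" "1 = cap2 k \<longleftrightarrow> k = 1" "2 = cap2 k \<longleftrightarrow> 2 \<le> k" for k
    by (auto simp: cap2_def min_def)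
  then show "0 \<in> cap2 ` X \<longleftrightarrow> 0 \<in> X" "1 \<in> cap2 ` X \<longleftrightarrow> 1 \<in> X" "2 \<in> cap2 ` X \<longleftrightarrow> (\<exists>k \<in> X. 2 \<le> k)"
    by (simp_all add: image_iff)
qed

lemma fit_cong: "cap2 ` X = cap2 ` Y \<Longrightarrow> fit X = fit Y"
  using mem_cap2_image[of X] mem_cap2_image[of Y] by (simp add: fit_def)

text \<open>The summand 1 pays for a tree \<open>t0\<close> that keeps the sample nonempty and fixes
  the root symbol, or for a single negative example if the language is empty. Only the cardinality
  is bounded, so the witnesses can be picked without regard to their size.\<close>

lemma characteristic_sample:
  assumes fin: "finite \<Sigma>" and S: "S \<in> MS \<Sigma>"
  obtains CS where "sample (trees_pm \<Sigma>) CS" "CS \<subseteq> schema_lang_pm \<Sigma> S"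
    "card CS \<le> 3 * card \<Sigma> * card \<Sigma> + 1"
    "\<And>D. sample (trees_pm \<Sigma>) D \<Longrightarrow> CS \<subseteq> D \<Longrightarrow> D \<subseteq> schema_lang_pm \<Sigma> S \<Longrightarrow>
      (\<exists>S' \<in> MS \<Sigma>. learner \<Sigma> D = Some S' \<and> schema_lang_pm \<Sigma> S' = schema_lang_pm \<Sigma> S)"
proof (cases "schema_lang \<Sigma> S = {}")
  case True
  \<comment> \<open>Every tree over \<Sigma> is a negative example here; \<open>root_sym S\<close>
    is a symbol known to lie in \<Sigma>.\<close>
  let ?t = "\<lparr>nodes = {0}, root_node = 0, lab = [0 \<mapsto> root_sym S], child = {}\<rparr> :: 'a tree"
  have t: "?t \<in> trees \<Sigma>" by (rule single_node_tree) (use S in \<open>simp add: MS_def\<close>)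
  show ?thesis
  proof (rule that[of "{(?t, Neg)}"])
    fix D assume D: "sample (trees_pm \<Sigma>) D" "D \<subseteq> schema_lang_pm \<Sigma> S"
    have "(t, Pos) \<notin> D" for t
    proof
      assume "(t, Pos) \<in> D"
      then have "(t, Pos) \<in> schema_lang_pm \<Sigma> S" using D(2) by (rule subsetD[rotated])
      then show False using True by (simp add: schema_lang_pm_def)
    qed
    then have none: "pos_roots D = {}" by (simp add: pos_roots_def)
    have Min: "Min \<Sigma> \<in> \<Sigma>" using root_choice_in_alphabet[OF fin D(1)] by simp
    from none have "if pos_roots D = {} then Min \<Sigma> = Min \<Sigma> else Min \<Sigma> \<in> pos_roots D" by simp
    from learner_eqI[OF fin D(1) this] consistent_candidate[OF fin S D(2) disjI1[OF none]]
    have L: "learner \<Sigma> D = Some (candidate \<Sigma> D (Min \<Sigma>))" by simp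
    have "schema_lang \<Sigma> (candidate \<Sigma> D (Min \<Sigma>)) = {}"
      using candidate_unsatisfiable[OF fin none] by (auto simp: schema_lang_def)
    then have eq: "schema_lang_pm \<Sigma> (candidate \<Sigma> D (Min \<Sigma>)) = schema_lang_pm \<Sigma> S"
      using True by (simp add: schema_lang_pm_def)
    show "\<exists>S' \<in> MS \<Sigma>. learner \<Sigma> D = Some S' \<and> schema_lang_pm \<Sigma> S' = schema_lang_pm \<Sigma> S"
      by (intro bexI[of _ "candidate \<Sigma> D (Min \<Sigma>)"] conjI L eq candidate_in_MS fin Min)
  next
    show "sample (trees_pm \<Sigma>) {(?t, Neg)}" using t by (simp add: sample_def trees_pm_def)
    show "{(?t, Neg)} \<subseteq> schema_lang_pm \<Sigma> S" using t True by (simp add: schema_lang_pm_def)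
  qed simp
next
  case False
  then obtain t0 where t0: "t0 \<in> schema_lang \<Sigma> S" by blast
  \<comment> \<open>The whole language as a set of positive examples, possibly infinite; the fits of
    \<open>D\<close> are shown to agree with its fits.\<close>
  define all where "all = schema_lang \<Sigma> S \<times> {Pos}"
  define wit where "wit = (\<lambda>(a, b, c). SOME t. t \<in> schema_lang \<Sigma> S \<and>
    (\<exists>n \<in> nodes t. label t n = a \<and> cap2 (ch t n b) = c))"
  define idx where "idx = {(a, b, c) \<in> \<Sigma> \<times> \<Sigma> \<times> {0, 1, 2}. \<exists>t n. t \<in> schema_lang \<Sigma> S \<and>
    n \<in> nodes t \<and> label t n = a \<and> cap2 (ch t n b) = c}"
  define CS where "CS = insert (t0, Pos) ((\<lambda>i. (wit i, Pos)) ` idx)"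
  have wit: "wit (a, b, c) \<in> schema_lang \<Sigma> S \<and>
    (\<exists>n \<in> nodes (wit (a, b, c)). label (wit (a, b, c)) n = a \<and> cap2 (ch (wit (a, b, c)) n b) = c)"
    if "(a, b, c) \<in> idx" for a b c
    unfolding wit_def prod.case by (rule someI_ex) (use that in \<open>auto simp: idx_def\<close>)
  have idx_sub: "idx \<subseteq> \<Sigma> \<times> \<Sigma> \<times> {0, 1, 2}" by (auto simp: idx_def)
  then have fin_idx: "finite idx" by (rule finite_subset) (use fin in simp)
  have "card idx \<le> card (\<Sigma> \<times> \<Sigma> \<times> {0, 1, 2 :: nat})" by (intro card_mono idx_sub) (use fin in simp)
  then have "card idx \<le> 3 * card \<Sigma> * card \<Sigma>" by (simp add: card_cartesian_product algebra_simps)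
  moreover have "card ((\<lambda>i. (wit i, Pos)) ` idx) \<le> card idx" using card_image_le[OF fin_idx] .
  ultimately have card: "card CS \<le> 3 * card \<Sigma> * card \<Sigma> + 1"
    unfolding CS_def by (simp add: card_insert_if fin_idx)
  have CS_all: "CS \<subseteq> all" using wit t0 by (auto simp: CS_def all_def)
  have all_sub: "all \<subseteq> schema_lang_pm \<Sigma> S" by (auto simp: all_def schema_lang_pm_def)
  show ?thesis
  proof (rule that[of CS])
    show "sample (trees_pm \<Sigma>) CS"
    proof -
      have "all \<subseteq> trees_pm \<Sigma>" by (auto simp: all_def trees_pm_def schema_lang_def)
      moreover have "finite CS" "CS \<noteq> {}" by (simp_all add: CS_def fin_idx)
      ultimately show ?thesis using CS_all by (simp add: sample_def)
    qed
    show "CS \<subseteq> schema_lang_pm \<Sigma> S" using CS_all all_sub by blast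
    show "card CS \<le> 3 * card \<Sigma> * card \<Sigma> + 1" by (rule card)
    fix D assume D: "sample (trees_pm \<Sigma>) D" "CS \<subseteq> D" "D \<subseteq> schema_lang_pm \<Sigma> S"
    define r where "r = root_sym S"
    have r: "r \<in> pos_roots D"
    proof -
      have "(t0, Pos) \<in> D" using D(2) by (simp add: CS_def)
      moreover have "r = label t0 (root_node t0)"
        using t0 by (simp add: r_def schema_lang_def satisfies_def)
      ultimately show ?thesis unfolding pos_roots_def by blast
    qed
    from r have "if pos_roots D = {} then r = Min \<Sigma> else r \<in> pos_roots D" by auto
    from learner_eqI[OF fin D(1) this] consistent_candidate[OF fin S D(3) disjI2[OF r]]
    have L: "learner \<Sigma> D = Some (candidate \<Sigma> D r)" by simp
    have pos: "t \<in> schema_lang \<Sigma> S" if "(t, Pos) \<in> D" for t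
      using D(3) that by (auto simp: schema_lang_def schema_lang_pm_Pos)
    \<comment> \<open>One inclusion holds because the positive examples of \<open>D\<close> lie in
      the language, the other because \<open>CS\<close> has a witness for every capped
      count.\<close>
    have fit_eq: "fit (obs D a b) = fit (obs all a b)" if ab: "a \<in> \<Sigma>" "b \<in> \<Sigma>" for a b
    proof (rule fit_cong, rule antisym)
      have "obs D a b \<subseteq> obs all a b" using pos unfolding obs_def all_def by blast
      then show "cap2 ` obs D a b \<subseteq> cap2 ` obs all a b" by (rule image_mono)
      show "cap2 ` obs all a b \<subseteq> cap2 ` obs D a b"
      proof
        fix c assume "c \<in> cap2 ` obs all a b"
        then obtain t n where tn: "t \<in> schema_lang \<Sigma> S" "n \<in> nodes t" "label t n = a"
          "cap2 (ch t n b) = c" by (auto simp: obs_def all_def)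
        have "c \<le> 2" unfolding tn(4)[symmetric] cap2_def by simp
        then have "c \<in> {0, 1, 2}" by auto
        with tn have idx: "(a, b, c) \<in> idx" using ab unfolding idx_def by blast
        then have "(wit (a, b, c), Pos) \<in> D" using D(2) unfolding CS_def by blast
        moreover obtain n' where n': "n' \<in> nodes (wit (a, b, c))" "label (wit (a, b, c)) n' = a"
          "cap2 (ch (wit (a, b, c)) n' b) = c" using wit[OF idx] by blast
        ultimately have "ch (wit (a, b, c)) n' b \<in> obs D a b" unfolding obs_def by blast
        then have "cap2 (ch (wit (a, b, c)) n' b) \<in> cap2 ` obs D a b" by (rule imageI)
        then show "c \<in> cap2 ` obs D a b" unfolding n'(3) .
      qed
    qed
    have "satisfies t (candidate \<Sigma> D r) \<longleftrightarrow> satisfies t S" if t: "t \<in> trees \<Sigma>" for t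
    proof
      \<comment> \<open>As \<open>t\<close> belongs to \<open>all\<close>, the candidate built from
        \<open>all\<close> accepts it; the equality of fits carries this over to
        \<open>D\<close>.\<close>
      assume sat: "satisfies t S"
      then have "(t, Pos) \<in> all" "label t (root_node t) = r"
        using t by (auto simp: all_def schema_lang_def satisfies_def r_def)
      then have "satisfies t (candidate \<Sigma> all r)"
        using satisfies_candidate_Pos[OF fin t, of all] by simp
      then show "satisfies t (candidate \<Sigma> D r)"
        using fit_eq label_in_alphabet[OF t] by (simp add: satisfies_candidate_iff[OF fin t])
    qed (rule candidate_least[OF fin S D(3) r t])
    then have "schema_lang \<Sigma> (candidate \<Sigma> D r) = schema_lang \<Sigma> S"
      unfolding schema_lang_def by blast
    then have eq: "schema_lang_pm \<Sigma> (candidate \<Sigma> D r) = schema_lang_pm \<Sigma> S"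
      by (simp add: schema_lang_pm_def)
    have "r \<in> \<Sigma>" using root_choice_in_alphabet[OF fin D(1)] r by blast
    show "\<exists>S' \<in> MS \<Sigma>. learner \<Sigma> D = Some S' \<and> schema_lang_pm \<Sigma> S' = schema_lang_pm \<Sigma> S"
      by (intro bexI[of _ "candidate \<Sigma> D r"] conjI L eq candidate_in_MS fin \<open>r \<in> \<Sigma>\<close>)
  qed
qed

text \<open>A schema has a rule for each symbol, so its size bounds the cardinality of \<Sigma>; the
  polynomial is 3 times the square, plus 1.\<close>

lemma complete_learner_learner:
  assumes fin: "finite \<Sigma>"
  shows "complete_learner (trees_pm \<Sigma>) (MS \<Sigma>) (schema_lang_pm \<Sigma>) schema_size [:1, 0, 3:] (learner \<Sigma>)"
  unfolding complete_learner_def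
proof
  fix S assume S: "S \<in> MS \<Sigma>"
  have "card \<Sigma> = (\<Sum>a \<in> dom (rule S). 1)" using S by (simp add: MS_def)
  also have "\<dots> \<le> (\<Sum>a \<in> dom (rule S). 1 + length (the (rule S a)))" by (intro sum_mono) simp
  finally have "card \<Sigma> \<le> schema_size S" by (simp add: schema_size_def)
  then have size: "3 * card \<Sigma> * card \<Sigma> + 1 \<le> poly [:1, 0, 3:] (schema_size S)"
    using mult_le_mono[of "card \<Sigma>" "schema_size S" "card \<Sigma>" "schema_size S"] by simp
  show "\<exists>CS. sample (trees_pm \<Sigma>) CS \<and> CS \<subseteq> schema_lang_pm \<Sigma> S \<and>
      card CS \<le> poly [:1, 0, 3:] (schema_size S) \<and>
      (\<forall>D. sample (trees_pm \<Sigma>) D \<and> CS \<subseteq> D \<and> D \<subseteq> schema_lang_pm \<Sigma> S \<longrightarrow>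
        (\<exists>S' \<in> MS \<Sigma>. learner \<Sigma> D = Some S' \<and> schema_lang_pm \<Sigma> S' = schema_lang_pm \<Sigma> S))"
  proof (rule characteristic_sample[OF fin S])
    fix CS :: "'a example set"
    assume "sample (trees_pm \<Sigma>) CS" "CS \<subseteq> schema_lang_pm \<Sigma> S"
      "card CS \<le> 3 * card \<Sigma> * card \<Sigma> + 1"
      "\<And>D. sample (trees_pm \<Sigma>) D \<Longrightarrow> CS \<subseteq> D \<Longrightarrow> D \<subseteq> schema_lang_pm \<Sigma> S \<Longrightarrow>
        (\<exists>S' \<in> MS \<Sigma>. learner \<Sigma> D = Some S' \<and> schema_lang_pm \<Sigma> S' = schema_lang_pm \<Sigma> S)"
    then show ?thesis using le_trans[OF _ size] by (intro exI[of _ CS] conjI allI impI) blast+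
  qed
qed

section \<open>Symbolic evaluation with a cost bound\<close>

definition calls :: "program \<Rightarrow> nat \<Rightarrow> 'a::linorder val list \<Rightarrow> 'a val \<Rightarrow> nat \<Rightarrow> bool" where
  "calls P f vs v K \<longleftrightarrow> f < length P \<and> (\<exists>k \<le> K. eval P vs (P ! f) v k)"

definition result :: "program \<Rightarrow> nat \<Rightarrow> 'a::linorder val list \<Rightarrow> 'a val" where
  "result P f vs = (THE v. \<exists>k. eval P vs (P ! f) v k)"

lemma calls_result: "calls P f vs v K \<Longrightarrow> result P f vs = v"
  unfolding result_def calls_def by (rule the_equality) (auto dest: eval_deterministic(1))

text \<open>With \<open>calls_result\<close> this makes two rewrite rules from the specification of
  a function: one gives the value of a call, the other discharges its safety condition.\<close>

lemma calls_safe: "calls P f vs v K \<Longrightarrow> \<exists>v. calls P f vs v K" by blast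

text \<open>The value \<open>result\<close> of a call is meaningful only for terminating calls, so \<open>safe\<close> demands
  that every call made terminates within the bound \<open>ct\<close>; then \<open>den\<close> is the value of the expression,
  and \<open>cost\<close>, which charges both branches of a conditional, bounds its cost.\<close>

context
  fixes P :: program and ct :: "nat \<Rightarrow> nat"
begin

fun den :: "'a::linorder val list \<Rightarrow> expr \<Rightarrow> 'a val" where
  "den \<rho> (EVar i) = \<rho> ! i"
| "den \<rho> ENil = VNil"
| "den \<rho> (EPair e1 e2) = VPair (den \<rho> e1) (den \<rho> e2)"
| "den \<rho> (EFst e) = vfst (den \<rho> e)"
| "den \<rho> (ESnd e) = vsnd (den \<rho> e)"
| "den \<rho> (EEq e1 e2) = vbool (veq (den \<rho> e1) (den \<rho> e2))"
| "den \<rho> (ELeq e1 e2) = vbool (vleq (den \<rho> e1) (den \<rho> e2))"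
| "den \<rho> (EIf e e1 e2) = (if den \<rho> e \<noteq> VNil then den \<rho> e1 else den \<rho> e2)"
| "den \<rho> (ELet e1 e2) = den (den \<rho> e1 # \<rho>) e2"
| "den \<rho> (ECall f es) = result P f (map (den \<rho>) es)"

fun safe :: "'a::linorder val list \<Rightarrow> expr \<Rightarrow> bool" where
  "safe \<rho> (EVar i) \<longleftrightarrow> i < length \<rho>"
| "safe \<rho> ENil \<longleftrightarrow> True"
| "safe \<rho> (EPair e1 e2) \<longleftrightarrow> safe \<rho> e1 \<and> safe \<rho> e2"
| "safe \<rho> (EFst e) \<longleftrightarrow> safe \<rho> e"
| "safe \<rho> (ESnd e) \<longleftrightarrow> safe \<rho> e"
| "safe \<rho> (EEq e1 e2) \<longleftrightarrow> safe \<rho> e1 \<and> safe \<rho> e2"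
| "safe \<rho> (ELeq e1 e2) \<longleftrightarrow> safe \<rho> e1 \<and> safe \<rho> e2"
| "safe \<rho> (EIf e e1 e2) \<longleftrightarrow> safe \<rho> e \<and>
    (den \<rho> e \<noteq> VNil \<longrightarrow> safe \<rho> e1) \<and> (den \<rho> e = VNil \<longrightarrow> safe \<rho> e2)"
| "safe \<rho> (ELet e1 e2) \<longleftrightarrow> safe \<rho> e1 \<and> safe (den \<rho> e1 # \<rho>) e2"
| "safe \<rho> (ECall f es) \<longleftrightarrow> (\<forall>e \<in> set es. safe \<rho> e) \<and>
    (\<exists>v. calls P f (map (den \<rho>) es) v (ct f))"

fun cost :: "expr \<Rightarrow> nat" where
  "cost (EVar i) = 1"
| "cost ENil = 1"
| "cost (EPair e1 e2) = 1 + cost e1 + cost e2"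
| "cost (EFst e) = 1 + cost e"
| "cost (ESnd e) = 1 + cost e"
| "cost (EEq e1 e2) = 1 + cost e1 + cost e2"
| "cost (ELeq e1 e2) = 1 + cost e1 + cost e2"
| "cost (EIf e e1 e2) = 1 + cost e + cost e1 + cost e2"
| "cost (ELet e1 e2) = 1 + cost e1 + cost e2"
| "cost (ECall f es) = 1 + sum_list (map cost es) + ct f"

lemma evals_den:
  assumes "\<And>e. e \<in> set es \<Longrightarrow> \<exists>k \<le> cost e. eval P \<rho> e (den \<rho> e) k"
  shows "\<exists>k \<le> sum_list (map cost es). evals P \<rho> es (map (den \<rho>) es) k"
  using assms
proof (induction es)
  case Nil
  then show ?case by (auto intro: evals_Nil)
next
  case (Cons e es)
  from Cons.prems obtain k where "k \<le> cost e" "eval P \<rho> e (den \<rho> e) k" by force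
  moreover from Cons obtain l where
    "l \<le> sum_list (map cost es)" "evals P \<rho> es (map (den \<rho>) es) l" by auto
  ultimately show ?case
    by (intro exI[of _ "k + l"]) (auto intro: evals_Cons)
qed

lemma eval_den: "safe \<rho> e \<Longrightarrow> \<exists>k \<le> cost e. eval P \<rho> e (den \<rho> e) k"
proof (induction \<rho> e rule: safe.induct)
  case (1 \<rho> i)
  then show ?case using EVar[of i \<rho> P] by (intro exI[of _ 1]) auto
next
  case (2 \<rho>)
  show ?case using ENil[of P \<rho>] by (intro exI[of _ 1]) auto
next
  case (3 \<rho> e1 e2)
  then obtain k l where "k \<le> cost e1" "eval P \<rho> e1 (den \<rho> e1) k"
    "l \<le> cost e2" "eval P \<rho> e2 (den \<rho> e2) l" by auto
  then show ?case by (intro exI[of _ "1 + k + l"])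
      (auto intro!: EPair simp del: One_nat_def plus_nat.simps add_Suc)
next
  case (4 \<rho> e)
  then obtain k where "k \<le> cost e" "eval P \<rho> e (den \<rho> e) k" by auto
  then show ?case using EFst by (intro exI[of _ "1 + k"]) auto
next
  case (5 \<rho> e)
  then obtain k where "k \<le> cost e" "eval P \<rho> e (den \<rho> e) k" by auto
  then show ?case using ESnd by (intro exI[of _ "1 + k"]) auto
next
  case (6 \<rho> e1 e2)
  then obtain k l where "k \<le> cost e1" "eval P \<rho> e1 (den \<rho> e1) k"
    "l \<le> cost e2" "eval P \<rho> e2 (den \<rho> e2) l" by auto
  then show ?case using EEq by (intro exI[of _ "1 + k + l"]) auto
next
  case (7 \<rho> e1 e2)
  then obtain k l where "k \<le> cost e1" "eval P \<rho> e1 (den \<rho> e1) k"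
    "l \<le> cost e2" "eval P \<rho> e2 (den \<rho> e2) l" by auto
  then show ?case using ELeq by (intro exI[of _ "1 + k + l"]) auto
next
  case (8 \<rho> e e1 e2)
  then obtain k where k: "k \<le> cost e" "eval P \<rho> e (den \<rho> e) k" by auto
  show ?case
  proof (cases "den \<rho> e = VNil")
    case True
    with 8 obtain l where "l \<le> cost e2" "eval P \<rho> e2 (den \<rho> e2) l" by auto
    then show ?thesis using k True EIf_False[of P \<rho> e k] by (intro exI[of _ "1 + k + l"]) auto
  next
    case False
    with 8 obtain l where "l \<le> cost e1" "eval P \<rho> e1 (den \<rho> e1) l" by auto
    then show ?thesis using k False EIf_True[of P \<rho> e _ k] by (intro exI[of _ "1 + k + l"]) auto
  qed
next
  case (9 \<rho> e1 e2)
  then obtain k l where "k \<le> cost e1" "eval P \<rho> e1 (den \<rho> e1) k"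
    "l \<le> cost e2" "eval P (den \<rho> e1 # \<rho>) e2 (den (den \<rho> e1 # \<rho>) e2) l" by auto
  then show ?case using ELet by (intro exI[of _ "1 + k + l"]) auto
next
  case (10 \<rho> f es)
  then obtain v where v: "calls P f (map (den \<rho>) es) v (ct f)" by auto
  then obtain k where k: "f < length P" "k \<le> ct f" "eval P (map (den \<rho>) es) (P ! f) v k"
    by (auto simp: calls_def)
  obtain l where "l \<le> sum_list (map cost es)" "evals P \<rho> es (map (den \<rho>) es) l"
    using evals_den 10 by (metis safe.simps(10))
  then show ?case using k calls_result[OF v] ECall
    by (intro exI[of _ "1 + l + k"]) auto
qed

text \<open>Serves the two functions without recursion, \<open>fit_body\<close> and
  \<open>main_body\<close>.\<close>

lemma calls_bodyI:
  assumes "f < length P" "safe vs (P ! f)" "den vs (P ! f) = v" "cost (P ! f) \<le> K"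
  shows "calls P f vs v K"
  using assms eval_den[of vs "P ! f"] by (auto simp: calls_def intro: le_trans)

end

text \<open>Structural recursion over the list in variable 0, with \<open>k\<close> further parameters passed on
  unchanged; in the step expression the recursive result is variable 0 and the list is variable 1.\<close>

definition fold_body :: "nat \<Rightarrow> nat \<Rightarrow> expr \<Rightarrow> expr \<Rightarrow> expr" where
  "fold_body f k base step = EIf (EVar 0)
     (ELet (ECall f (ESnd (EVar 0) # map EVar [1..<Suc k])) step) base"

lemma evals_vars:
  assumes "set is \<subseteq> {..<length \<rho>}"
  shows "evals P \<rho> (map EVar is) (map (\<lambda>i. \<rho> ! i) is) (length is)"
  using assms
proof (induction "is")
  case (Cons i "is")
  then show ?case using evals_Cons[OF EVar[of i \<rho> P]] by simp
qed (simp add: evals_Nil)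

text \<open>\<open>F\<close> is the intended result on a suffix of the list. The step may assume
  that the elements come from \<open>xs\<close> and that the suffix is shorter, which gives access
  to length bounds for inner calls. The 6 counts the fixed constructs of an unfolding: the
  conditional and its variable, the let, the call, and the tail with its variable.\<close>

lemma fold_calls:
  fixes r :: "'b \<Rightarrow> 'a::linorder val"
  assumes f: "f < length P" "P ! f = fold_body f k base step" "length ps = k"
    and base: "safe P ct (VNil # ps) base" "den P (VNil # ps) base = F []"
    and step: "\<And>x zs. x \<in> set xs \<Longrightarrow> set zs \<subseteq> set xs \<Longrightarrow> length zs < length xs \<Longrightarrow>
      safe P ct (F zs # vlist (map r (x # zs)) # ps) step \<and>
      den P (F zs # vlist (map r (x # zs)) # ps) step = F (x # zs)"
    and len: "length xs < b"
    and K: "b * (cost ct base + cost ct step + length ps + 6) \<le> K"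
  shows "calls P f (vlist (map r xs) # ps) (F xs) K"
proof -
  let ?C = "cost ct base + cost ct step + length ps + 6"
  have vars: "evals P (v # ps) (map EVar [1..<Suc (length ps)]) ps (length ps)"
    for v :: "'a val"
  proof -
    have "map (\<lambda>i. (v # ps) ! i) [1..<Suc (length ps)] = ps" 
      by (simp add: map_Suc_upt[symmetric] o_def map_nth del: upt_Suc)
    moreover have "set [1..<Suc (length ps)] \<subseteq> {..<length (v # ps)}" by auto
    ultimately show ?thesis using evals_vars[of "[1..<Suc (length ps)]" "v # ps" P] 
      by (simp del: upt_Suc set_upt)
  qed
  have "\<exists>k \<le> (length zs + 1) * ?C. eval P (vlist (map r zs) # ps) (P ! f) (F zs) k"
    if "set zs \<subseteq> set xs" "length zs \<le> length xs" for zs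
    using that
  proof (induction zs)
    case Nil
    obtain k where k: "k \<le> cost ct base" "eval P (VNil # ps) base (F []) k"
      using eval_den[OF base(1)] base(2) by auto
    have "eval P (VNil # ps) (EVar 0) VNil 1" using EVar[of 0 "VNil # ps" P] by simp
    from EIf_False[OF this k(2)] show ?case
      unfolding f(2) fold_body_def f(3)[symmetric] using k(1) by (intro exI[of _ "1 + 1 + k"]) auto
  next
    case (Cons x zs)
    let ?v = "vlist (map r (x # zs))"
    from Cons obtain k where k: "k \<le> (length zs + 1) * ?C"
      "eval P (vlist (map r zs) # ps) (P ! f) (F zs) k" by auto
    obtain l where l: "l \<le> cost ct step" "eval P (F zs # ?v # ps) step (F (x # zs)) l"
      using eval_den[of P ct _ step] step[of x zs] Cons.prems
      by (metis insert_subset length_Cons less_eq_Suc_le list.simps(15))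
    have var: "eval P (?v # ps) (EVar 0) ?v 1" using EVar[of 0 "?v # ps" P] by simp
    have "evals P (?v # ps) (ESnd (EVar 0) # map EVar [1..<Suc (length ps)])
        (vlist (map r zs) # ps) (1 + 1 + length ps)"
      using evals_Cons[OF ESnd[OF var] vars] by (simp del: upt_Suc)
    from EIf_True[OF var _ ELet[OF ECall[OF this f(1) k(2)] l(2)]]
    have "eval P (?v # ps) (P ! f) (F (x # zs)) (1 + 1 + (1 + (1 + (1 + 1 + length ps) + k) + l))"
      unfolding f(2) fold_body_def f(3)[symmetric] by (simp del: upt_Suc)
    moreover have "1 + 1 + (1 + (1 + (1 + 1 + length ps) + k) + l) \<le> (length (x # zs) + 1) * ?C"
      using k(1) l(1) by simp
    ultimately show ?case by blast
  qed
  from this[of xs] obtain k where k: "k \<le> (length xs + 1) * ?C"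
    "eval P (vlist (map r xs) # ps) (P ! f) (F xs) k" by auto
  \<comment> \<open>The call on the empty list is counted too, hence the strict bound on the
    length.\<close>
  have "(length xs + 1) * ?C \<le> b * ?C" using len by (intro mult_le_mono1) simp
  then show ?thesis using k K f(1) by (auto simp: calls_def intro: le_trans)
qed

section \<open>The program\<close>

text \<open>The functions are, in the order of their indices: 0 main, 1 sort, 2 sorted insertion, 3 root
  label of the first positive example, 4 label of a node, 5 consistency of a list of examples,
  6 and 7 conformity of a list of nodes and of one node for a list of symbols, 8 rules of the schema,
  9 expression of a symbol, 10 least multiplicity, 11 and 12 observed numbers of children in a list
  of examples and in one example, 13 number of children, 14 edge test. Three flags stand for a set
  of observed numbers: whether it contains 0, 1, and a number greater than 1.\<close>

abbreviation "etrue \<equiv> EPair ENil ENil"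
abbreviation "hd_var \<equiv> EFst (EVar 1)"

abbreviation "edge_step \<equiv>
  EIf (EEq (EFst hd_var) (EVar 2)) (EIf (EEq (ESnd hd_var) (EVar 3)) etrue (EVar 0)) (EVar 0)"

abbreviation "count_step \<equiv>
  EIf (EEq (ESnd hd_var) (EVar 3))
    (EIf (ECall 14 [EVar 4, EVar 2, EFst hd_var]) (EPair ENil (EVar 0)) (EVar 0)) (EVar 0)"

abbreviation "obs_node_step \<equiv>
  EIf (EEq (ESnd hd_var) (EVar 2))
    (ELet (ECall 13 [EVar 4, EFst hd_var, EVar 3, EVar 5])
      (EIf (EVar 0)
        (EIf (ESnd (EVar 0))
          (EPair (EFst (EVar 1)) (EPair (EFst (ESnd (EVar 1))) etrue))
          (EPair (EFst (EVar 1)) (EPair etrue (ESnd (ESnd (EVar 1))))))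
        (EPair etrue (ESnd (EVar 1)))))
    (EVar 0)"

abbreviation "nodes_of e \<equiv> EFst (ESnd (ESnd e))"
abbreviation "edges_of e \<equiv> ESnd (ESnd (ESnd e))"

abbreviation "obs_step \<equiv>
  EIf (EFst hd_var)
    (ECall 12 [nodes_of hd_var, EVar 2, EVar 3, nodes_of hd_var, edges_of hd_var, EVar 0])
    (EVar 0)"

text \<open>A multiplicity is coded by the length of a list of nils, from 0 for \<open>Star\<close>
  to 4 for \<open>Zero\<close>. Thus \<open>ENil\<close> is \<open>Star\<close>, and
  \<open>etrue\<close>, being a list of one nil, is \<open>Plus\<close>.\<close>

abbreviation "fit_body \<equiv>
  ELet (ECall 11 [EVar 0, EVar 1, EVar 2])
    (EIf (ESnd (ESnd (EVar 0)))
      (EIf (EFst (EVar 0)) ENil etrue)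
      (EIf (EFst (EVar 0))
        (EIf (EFst (ESnd (EVar 0))) (EPair ENil etrue)
          (EPair ENil (EPair ENil (EPair ENil etrue))))
        (EPair ENil (EPair ENil etrue))))"

abbreviation "dme_step \<equiv>
  EPair (EPair hd_var (ECall 10 [EVar 2, EVar 3, hd_var])) (EVar 0)"

abbreviation "rules_step \<equiv>
  EPair (EPair hd_var (ECall 9 [EVar 2, EVar 3, hd_var])) (EVar 0)"

text \<open>The flags are recomputed from the whole sample for each node and symbol. Inside both
  lets, variable 0 is the number of children and variable 1 the flags.\<close>

abbreviation "symbol_ok_step \<equiv>
  EIf (EVar 0)
    (ELet (ECall 11 [EVar 2, EVar 3, hd_var])
      (ELet (ECall 13 [EVar 6, EVar 5, EFst (EVar 2), EVar 7])
        (EIf (EVar 0)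
          (EIf (ESnd (EVar 0))
            (ESnd (ESnd (EVar 1)))
            (EIf (EFst (EVar 1)) (EIf (EFst (ESnd (EVar 1))) etrue (ESnd (ESnd (EVar 1)))) etrue))
          (EFst (EVar 1)))))
    ENil"

abbreviation "node_ok_step \<equiv>
  EIf (EVar 0)
    (ECall 7 [EVar 2, EVar 3, ESnd hd_var, EFst hd_var, EVar 4, EVar 5])
    ENil"

abbreviation "check_step \<equiv>
  EIf (EVar 0)
    (ELet
      (EIf (EEq (ECall 4 [nodes_of hd_var, EFst (ESnd hd_var)]) (EVar 4))
        (ECall 6 [nodes_of hd_var, EVar 2, EVar 3, nodes_of hd_var, edges_of hd_var])
        ENil)
      (EIf (EFst (EFst (EVar 2))) (EVar 0) (EIf (EVar 0) ENil etrue)))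
    ENil"

abbreviation "lab_step \<equiv> EIf (EEq (EFst hd_var) (EVar 2)) (ESnd hd_var) (EVar 0)"

abbreviation "root_step \<equiv>
  EIf (EFst hd_var) (ECall 4 [nodes_of hd_var, EFst (ESnd hd_var)]) (EVar 0)"

abbreviation "insert_step \<equiv>
  EIf (ELeq (EVar 2) hd_var) (EPair (EVar 2) (EVar 1)) (EPair hd_var (EVar 0))"

abbreviation "sort_step \<equiv> ECall 2 [EVar 0, hd_var]"

text \<open>Function 5 receives the examples twice: one copy is consumed by its recursion, the other
  supplies the fits. The same holds for the alphabet in function 8.\<close>

abbreviation "main_body \<equiv>
  ELet (ECall 1 [EVar 0])
    (ELet (ECall 3 [EVar 2, EFst (EVar 0)])
      (EIf (ECall 5 [EVar 3, EVar 1, EVar 3, EVar 0])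
        (EPair (EPair (EVar 0) (ECall 8 [EVar 1, EVar 1, EVar 3])) ENil)
        ENil))"

text \<open>Parameters start at index 1 in a base expression and at index 2 in a step; the base
  \<open>EVar 5\<close> of function 12 is thus its last parameter, the flags to be extended.\<close>

definition prog :: program where
  "prog =
    [main_body,
     fold_body 1 0 ENil sort_step,
     fold_body 2 1 (EPair (EVar 1) ENil) insert_step,
     fold_body 3 1 (EVar 1) root_step,
     fold_body 4 1 ENil lab_step,
     fold_body 5 3 etrue check_step,
     fold_body 6 4 etrue node_ok_step,
     fold_body 7 5 etrue symbol_ok_step,
     fold_body 8 2 ENil rules_step,
     fold_body 9 2 ENil dme_step,
     fit_body,
     fold_body 11 2 (EPair ENil etrue) obs_step,
     fold_body 12 5 (EVar 5) obs_node_step,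
     fold_body 13 3 ENil count_step,
     fold_body 14 2 ENil edge_step]"

text \<open>The exponent is the nesting depth of the loops; \<open>B\<close> will be 1000 times a strict upper bound on
  the lengths of all lists.\<close>

definition ct :: "nat \<Rightarrow> nat \<Rightarrow> nat" where
  "ct B f = B ^ ([8, 2, 1, 2, 1, 7, 6, 5, 7, 6, 5, 4, 3, 2, 1] ! f)"

lemma prog_nth:
  "prog ! 0 = main_body"
  "prog ! 1 = fold_body 1 0 ENil sort_step"
  "prog ! 2 = fold_body 2 1 (EPair (EVar 1) ENil) insert_step"
  "prog ! 3 = fold_body 3 1 (EVar 1) root_step"
  "prog ! 4 = fold_body 4 1 ENil lab_step"
  "prog ! 5 = fold_body 5 3 etrue check_step"
  "prog ! 6 = fold_body 6 4 etrue node_ok_step"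
  "prog ! 7 = fold_body 7 5 etrue symbol_ok_step"
  "prog ! 8 = fold_body 8 2 ENil rules_step"
  "prog ! 9 = fold_body 9 2 ENil dme_step"
  "prog ! 10 = fit_body"
  "prog ! 11 = fold_body 11 2 (EPair ENil etrue) obs_step"
  "prog ! 12 = fold_body 12 5 (EVar 5) obs_node_step"
  "prog ! 13 = fold_body 13 3 ENil count_step"
  "prog ! 14 = fold_body 14 2 ENil edge_step"
  by (simp_all add: prog_def)

lemma length_prog: "length prog = 15"
  by (simp add: prog_def)

section \<open>Encodings of the data as values\<close>

lemma vbool_simps [simp]: "vbool True = VPair VNil VNil" "vbool False = VNil" "vbool Q = VNil \<longleftrightarrow> \<not> Q"
  "VNil = vbool Q \<longleftrightarrow> \<not> Q" "vbool Q = VPair VNil VNil \<longleftrightarrow> Q" "VPair VNil VNil = vbool Q \<longleftrightarrow> Q"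
  by (simp_all add: vbool_def)

definition vnode :: "(nat \<Rightarrow> 'a) \<Rightarrow> nat \<Rightarrow> 'a val" where
  "vnode l n = VPair (VNode n) (VSym (l n))"

definition vedge :: "nat \<times> nat \<Rightarrow> 'a val" where
  "vedge p = VPair (VNode (fst p)) (VNode (snd p))"

text \<open>Unary numbers: the language has no arithmetic, and telling 0, 1 and larger numbers apart
  needs only nil tests on the list and its tail.\<close>

definition vnum :: "nat \<Rightarrow> 'a val" where
  "vnum k = vlist (replicate k VNil)"

lemma vnum_simps [simp]: "vnum 0 = VNil" "vnum (Suc k) = VPair VNil (vnum k)" "vnum k = VNil \<longleftrightarrow> k = 0"
  by (simp_all add: vnum_def) (cases k; simp)

text \<open>An example with the enumerations of its nodes and of its edges that a representation fixes.\<close>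

type_synonym 'a listed_example = "'a example \<times> nat list \<times> (nat \<times> nat) list"

abbreviation "ex_tree x \<equiv> fst (fst x)"
abbreviation "ex_nodes x \<equiv> fst (snd x)"
abbreviation "ex_edges x \<equiv> snd (snd x)"
abbreviation "ex_set xs \<equiv> fst ` set xs"

definition vexample :: "'a listed_example \<Rightarrow> 'a val" where
  "vexample x = VPair (vbool (snd (fst x) = Pos)) (VPair (VNode (root_node (ex_tree x)))
     (VPair (vlist (map (vnode (label (ex_tree x))) (ex_nodes x))) (vlist (map vedge (ex_edges x)))))"

definition listed :: "nat \<Rightarrow> 'a listed_example \<Rightarrow> bool" where
  "listed b x \<longleftrightarrow> distinct (ex_nodes x) \<and> set (ex_nodes x) = nodes (ex_tree x) \<and>
     set (ex_edges x) = child (ex_tree x) \<and> length (ex_nodes x) < b \<and> length (ex_edges x) < b \<and>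
     root_node (ex_tree x) \<in> nodes (ex_tree x)"

text \<open>The enumeration of the nodes has no repetitions, so the program counts no child
  twice.\<close>

lemma ch_listed:
  assumes "listed b x"
  shows "length (filter (\<lambda>m. label (ex_tree x) m = c \<and> (n, m) \<in> child (ex_tree x)) (ex_nodes x)) =
    ch (ex_tree x) n c"
proof -
  have "distinct (filter (\<lambda>m. label (ex_tree x) m = c \<and> (n, m) \<in> child (ex_tree x)) (ex_nodes x))"
    using assms by (simp add: listed_def)
  from distinct_card[OF this] show ?thesis
    using assms by (simp add: ch_def listed_def Collect_conj_eq Int_ac conj_ac)
qed

definition vobs :: "nat set \<Rightarrow> 'a val" where
  "vobs X = VPair (vbool (0 \<in> X)) (VPair (vbool (1 \<in> X)) (vbool (\<exists>k \<in> X. 2 \<le> k)))"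

lemma nat_cases3:
  obtains "n = 0" | "n = Suc 0" | k where "n = Suc (Suc k)"
  by (metis not0_implies_Suc)

lemma vobs_insert:
  "vobs (insert 0 X) = VPair (VPair VNil VNil) (vsnd (vobs X))"
  "vobs (insert (Suc 0) X) = VPair (vfst (vobs X)) (VPair (VPair VNil VNil) (vsnd (vsnd (vobs X))))"
  "vobs (insert (Suc (Suc k)) X) = VPair (vfst (vobs X)) (VPair (vfst (vsnd (vobs X))) (VPair VNil VNil))"
  by (simp_all add: vobs_def)

lemma obs_insert:
  "obs (insert (t, s) D) a c =
    obs D a c \<union> (if s = Pos then (\<lambda>n. ch t n c) ` {n \<in> nodes t. label t n = a} else {})"
  by (auto simp: obs_def)

fun root_label :: "'a listed_example list \<Rightarrow> 'a \<Rightarrow> 'a" where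
  "root_label [] d = d"
| "root_label (x # xs) d = (if snd (fst x) = Pos then label (ex_tree x) (root_node (ex_tree x))
     else root_label xs d)"

lemma vdme_simps [simp]:
  "vdme [] = VNil" "vdme ((a, M) # E) = VPair (VPair (VSym a) (vmult M)) (vdme E)"
  by (simp_all add: vdme_def)

definition fits :: "'a list \<Rightarrow> 'a listed_example list \<Rightarrow> 'a \<Rightarrow> 'a dme" where
  "fits s xs a = map (\<lambda>c. (c, fit (obs (ex_set xs) a c))) s"

definition node_ok :: "'a set \<Rightarrow> 'a example set \<Rightarrow> 'a tree \<Rightarrow> nat \<Rightarrow> bool" where
  "node_ok \<Sigma> D t n \<longleftrightarrow> (\<forall>c \<in> \<Sigma>. ch t n c \<in> mult_sem (fit (obs D (label t n) c)))"

definition example_ok :: "'a set \<Rightarrow> 'a example set \<Rightarrow> 'a \<Rightarrow> 'a example \<Rightarrow> bool" where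
  "example_ok \<Sigma> D r e \<longleftrightarrow> (snd e = Pos \<longleftrightarrow>
     label (fst e) (root_node (fst e)) = r \<and> (\<forall>n \<in> nodes (fst e). node_ok \<Sigma> D (fst e) n))"

section \<open>Correctness and running time of each function\<close>

context
  fixes b B :: nat
  assumes b: "0 < b" "1000 * b \<le> B"
begin

text \<open>A loop makes at most \<open>b\<close> rounds, and 1000 is a generous bound on the
  constant in the cost of a round. A single factor \<open>B\<close> absorbs both, so constants do
  not pile up in nested loops.\<close>

lemma cost_leI:
  assumes "x \<le> 1000 * B ^ d" "K = B ^ e" "e = Suc d"
  shows "b * x \<le> K"
proof -
  have "b * x \<le> b * (1000 * B ^ d)" using assms(1) by (rule mult_le_mono2)
  also have "\<dots> = (1000 * b) * B ^ d" by simp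
  also have "\<dots> \<le> B * B ^ d" using b(2) by (rule mult_le_mono1)
  finally show ?thesis using assms(2,3) by simp
qed

lemma B_ge: "1000 \<le> B"
  using b by linarith

lemma powers: "1 \<le> B ^ k" "i \<le> j \<Longrightarrow> B ^ i \<le> B ^ j"
  using b by (auto intro: power_increasing)

lemma calls_edge:
  assumes "length es < b"
  shows "calls prog 14 [vlist (map vedge es), VNode n, VNode m] (vbool ((n, m) \<in> set es)) (ct B 14)"
proof (rule fold_calls[where F = "\<lambda>es. vbool ((n, m) \<in> set es)" and ct = "ct B" and b = b,
    OF _ prog_nth(15)])
  show "b * (cost (ct B) ENil + cost (ct B) edge_step + length [VNode n, VNode m] + 6) \<le> ct B 14"
    by (rule cost_leI[where d = 0 and e = 1]) (simp_all add: ct_def)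
qed (use assms in \<open>auto simp: length_prog vedge_def\<close>)

lemmas edge_simps = calls_result[OF calls_edge] calls_safe[OF calls_edge]

lemma calls_count:
  assumes "length es < b" "length ns < b"
  shows "calls prog 13 [vlist (map (vnode l) ns), VNode n, VSym c, vlist (map vedge es)]
    (vnum (length (filter (\<lambda>m. l m = c \<and> (n, m) \<in> set es) ns))) (ct B 13)"
proof (rule fold_calls[where F = "\<lambda>ns. vnum (length (filter (\<lambda>m. l m = c \<and> (n, m) \<in> set es) ns))"
      and ct = "ct B" and b = b, OF _ prog_nth(14)])
  show "b * (cost (ct B) ENil + cost (ct B) count_step
      + length [VNode n, VSym c, vlist (map vedge es)] + 6) \<le> ct B 13"
    using powers(1)[of 1] by (intro cost_leI[where d = 1 and e = 2]) (simp_all add: ct_def)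
qed (use assms in \<open>auto simp: length_prog vnode_def edge_simps\<close>)

lemma calls_count_listed:
  assumes "listed b x"
  shows "calls prog 13 [vlist (map (vnode (label (ex_tree x))) (ex_nodes x)), VNode n, VSym c,
      vlist (map vedge (ex_edges x))] (vnum (ch (ex_tree x) n c)) (ct B 13)"
  using calls_count[of "ex_edges x" "ex_nodes x" "label (ex_tree x)" n c] assms
  by (simp add: listed_def ch_listed[OF assms])

lemmas count_simps = calls_result[OF calls_count_listed] calls_safe[OF calls_count_listed]

text \<open>The recursion consumes \<open>ns\<close>, while children are counted in the full node
  list. The set \<open>X\<close> is what the remaining examples have contributed.\<close>

lemma calls_obs_node:
  assumes x: "listed b x" and len: "length ns < b"
  shows "calls prog 12 [vlist (map (vnode (label (ex_tree x))) ns), VSym a, VSym c,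
      vlist (map (vnode (label (ex_tree x))) (ex_nodes x)), vlist (map vedge (ex_edges x)), vobs X]
    (vobs (X \<union> (\<lambda>n. ch (ex_tree x) n c) ` set (filter (\<lambda>n. label (ex_tree x) n = a) ns))) (ct B 12)"
proof (rule fold_calls[where ct = "ct B" and b = b and
      F = "\<lambda>ns. vobs (X \<union> (\<lambda>n. ch (ex_tree x) n c) ` set (filter (\<lambda>n. label (ex_tree x) n = a) ns))",
      OF _ prog_nth(13)])
  show "b * (cost (ct B) (EVar 5) + cost (ct B) obs_node_step
      + length [VSym a, VSym c, vlist (map (vnode (label (ex_tree x))) (ex_nodes x)),
          vlist (map vedge (ex_edges x)), vobs X] + 6) \<le> ct B 12"
    using powers(1)[of 2] by (intro cost_leI[where d = 2 and e = 3]) (simp_all add: ct_def)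
next
  fix n :: nat and ns' :: "nat list"
  let ?X = "X \<union> (\<lambda>n. ch (ex_tree x) n c) ` set (filter (\<lambda>n. label (ex_tree x) n = a) ns')"
  show "safe prog (ct B) (vobs ?X # vlist (map (vnode (label (ex_tree x))) (n # ns')) # 
      [VSym a, VSym c, vlist (map (vnode (label (ex_tree x))) (ex_nodes x)),
          vlist (map vedge (ex_edges x)), vobs X]) obs_node_step \<and>
    den prog (vobs ?X # vlist (map (vnode (label (ex_tree x))) (n # ns')) # 
      [VSym a, VSym c, vlist (map (vnode (label (ex_tree x))) (ex_nodes x)),
          vlist (map vedge (ex_edges x)), vobs X]) obs_node_step =
    vobs (X \<union> (\<lambda>n. ch (ex_tree x) n c) ` set (filter (\<lambda>n. label (ex_tree x) n = a) (n # ns')))"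
    by (cases "ch (ex_tree x) n c" rule: nat_cases3)
      (simp_all add: vnode_def count_simps[OF x] vobs_insert)
qed (use len in \<open>simp_all add: length_prog\<close>)

lemmas obs_node_simps = calls_result[OF calls_obs_node] calls_safe[OF calls_obs_node]

lemma calls_obs:
  assumes "\<And>x. x \<in> set xs \<Longrightarrow> listed b x" and "length xs < b"
  shows "calls prog 11 [vlist (map vexample xs), VSym a, VSym c] (vobs (obs (ex_set xs) a c)) (ct B 11)"
proof (rule fold_calls[where ct = "ct B" and b = b and F = "\<lambda>xs. vobs (obs (ex_set xs) a c)",
      OF _ prog_nth(12)])
  show "b * (cost (ct B) (EPair ENil etrue) + cost (ct B) obs_step + length [VSym a, VSym c] + 6) \<le> ct B 11"
    using powers(1)[of 3] by (intro cost_leI[where d = 3 and e = 4]) (simp_all add: ct_def)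
next
  show "den prog [VNil, VSym a, VSym c] (EPair ENil etrue) = vobs (obs (ex_set []) a c)"
    by (simp add: vobs_def obs_def)
next
  fix x zs assume "x \<in> set xs" "set zs \<subseteq> set xs"
  then have x: "listed b x" using assms by blast
  then have "length (ex_nodes x) < b" "set (ex_nodes x) = nodes (ex_tree x)" by (auto simp: listed_def)
  \<comment> \<open>Displays the example as a pair, the form that \<open>obs_insert\<close>
    rewrites.\<close>
  moreover have "insert (fst x) (ex_set zs) = insert (fst (fst x), snd (fst x)) (ex_set zs)" by simp
  ultimately show "safe prog (ct B) (vobs (obs (ex_set zs) a c) # vlist (map vexample (x # zs)) #
      [VSym a, VSym c]) obs_step \<and>
    den prog (vobs (obs (ex_set zs) a c) # vlist (map vexample (x # zs)) # [VSym a, VSym c]) obs_step =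
    vobs (obs (ex_set (x # zs)) a c)"
    using x by (simp add: vexample_def obs_node_simps obs_insert del: prod.collapse)
qed (use assms in \<open>simp_all add: length_prog\<close>)

lemmas obs_simps = calls_result[OF calls_obs] calls_safe[OF calls_obs]

lemma calls_fit:
  assumes "\<And>x. x \<in> set xs \<Longrightarrow> listed b x" and "length xs < b"
  shows "calls prog 10 [vlist (map vexample xs), VSym a, VSym c] (vmult (fit (obs (ex_set xs) a c))) (ct B 10)"
proof (rule calls_bodyI[where ct = "ct B"], unfold prog_nth(11))
  show "cost (ct B) fit_body \<le> ct B 10"
  proof -
    \<comment> \<open>There is no loop here; the additional factor \<open>B\<close> only absorbs the
      constant.\<close>
    have "B ^ 5 = B * B ^ 4" using power_Suc[of B 4] by simp
    then have "1000 * B ^ 4 \<le> B ^ 5" using mult_le_mono1[OF B_ge, of "B ^ 4"] by metis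
    then show ?thesis using powers(1)[of 4] by (simp add: ct_def)
  qed
  show "den prog [vlist (map vexample xs), VSym a, VSym c] fit_body = vmult (fit (obs (ex_set xs) a c))"
    using assms by (simp add: obs_simps) (simp add: vobs_def fit_def)
qed (use assms in \<open>simp_all add: length_prog obs_simps\<close>)

lemmas fit_simps = calls_result[OF calls_fit] calls_safe[OF calls_fit]

lemma calls_dme:
  assumes xs: "\<And>x. x \<in> set xs \<Longrightarrow> listed b x" "length xs < b" and s: "length s < b"
  shows "calls prog 9 [vlist (map VSym s), vlist (map vexample xs), VSym a] (vdme (fits s xs a)) (ct B 9)"
proof (rule fold_calls[where ct = "ct B" and b = b and F = "\<lambda>s. vdme (fits s xs a)", OF _ prog_nth(10)])
  show "b * (cost (ct B) ENil + cost (ct B) dme_step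
      + length [vlist (map vexample xs), VSym a] + 6) \<le> ct B 9"
    using powers(1)[of 5] by (intro cost_leI[where d = 5 and e = 6]) (simp_all add: ct_def)
qed (use s in \<open>simp_all add: length_prog fits_def fit_simps[OF xs]\<close>)

lemmas dme_simps = calls_result[OF calls_dme] calls_safe[OF calls_dme]

lemma calls_rules:
  assumes xs: "\<And>x. x \<in> set xs \<Longrightarrow> listed b x" "length xs < b" and s: "length s < b" "length s' < b"
  shows "calls prog 8 [vlist (map VSym s'), vlist (map VSym s), vlist (map vexample xs)]
    (vlist (map (\<lambda>a. VPair (VSym a) (vdme (fits s xs a))) s')) (ct B 8)"
proof (rule fold_calls[where ct = "ct B" and b = b and
      F = "\<lambda>s'. vlist (map (\<lambda>a. VPair (VSym a) (vdme (fits s xs a))) s')", OF _ prog_nth(9)])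
  show "b * (cost (ct B) ENil + cost (ct B) rules_step
      + length [vlist (map VSym s), vlist (map vexample xs)] + 6) \<le> ct B 8"
    using powers(1)[of 6] by (intro cost_leI[where d = 6 and e = 7]) (simp_all add: ct_def)
qed (use s in \<open>simp_all add: length_prog dme_simps[OF xs]\<close>)

lemma calls_label:
  assumes "length ns < b"
  shows "calls prog 4 [vlist (map (vnode l) ns), VNode n] (if n \<in> set ns then VSym (l n) else VNil) (ct B 4)"
proof (rule fold_calls[where ct = "ct B" and b = b and
      F = "\<lambda>ns. if n \<in> set ns then VSym (l n) else VNil", OF _ prog_nth(5)])
  show "b * (cost (ct B) ENil + cost (ct B) lab_step + length [VNode n] + 6) \<le> ct B 4"
    by (intro cost_leI[where d = 0 and e = 1]) (simp_all add: ct_def)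
qed (use assms in \<open>auto simp: length_prog vnode_def\<close>)

lemma calls_root_label:
  assumes "listed b x"
  shows "calls prog 4 [vlist (map (vnode (label (ex_tree x))) (ex_nodes x)), VNode (root_node (ex_tree x))]
    (VSym (label (ex_tree x) (root_node (ex_tree x)))) (ct B 4)"
  using calls_label[of "ex_nodes x" "label (ex_tree x)" "root_node (ex_tree x)"] assms
  by (simp add: listed_def)

lemmas root_label_simps = calls_result[OF calls_root_label] calls_safe[OF calls_root_label]

lemma calls_root:
  assumes xs: "\<And>x. x \<in> set xs \<Longrightarrow> listed b x" "length xs < b"
  shows "calls prog 3 [vlist (map vexample xs), VSym d] (VSym (root_label xs d)) (ct B 3)"
proof (rule fold_calls[where ct = "ct B" and b = b and F = "\<lambda>xs. VSym (root_label xs d)",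
      OF _ prog_nth(4)])
  show "b * (cost (ct B) (EVar 1) + cost (ct B) root_step + length [VSym d] + 6) \<le> ct B 3"
    using powers(1)[of 1] by (intro cost_leI[where d = 1 and e = 2]) (simp_all add: ct_def)
qed (use xs in \<open>simp_all add: length_prog vexample_def root_label_simps\<close>)

lemmas root_simps = calls_result[OF calls_root] calls_safe[OF calls_root]

lemma calls_insert:
  assumes "length s < b"
  shows "calls prog 2 [vlist (map VSym s), VSym c] (vlist (map VSym (insort c s))) (ct B 2)"
proof (rule fold_calls[where ct = "ct B" and b = b and F = "\<lambda>s. vlist (map VSym (insort c s))",
      OF _ prog_nth(3)])
  show "b * (cost (ct B) (EPair (EVar 1) ENil) + cost (ct B) insert_step + length [VSym c] + 6) \<le> ct B 2"
    by (intro cost_leI[where d = 0 and e = 1]) (simp_all add: ct_def)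
qed (use assms in \<open>simp_all add: length_prog\<close>)

lemmas insert_simps = calls_result[OF calls_insert] calls_safe[OF calls_insert]

lemma calls_sort:
  fixes s :: "'a::linorder list"
  assumes "length s < b"
  shows "calls prog 1 [vlist (map VSym s)] (vlist (map VSym (sort s))) (ct B 1)"
proof (rule fold_calls[where ct = "ct B" and b = b and F = "\<lambda>s. vlist (map VSym (sort s))" and xs = s,
      OF _ prog_nth(2)])
  show "b * (cost (ct B) ENil + cost (ct B) sort_step + length [] + 6) \<le> ct B 1"
    by (intro cost_leI[where d = 1 and e = 2]) (use powers(1)[of 1] in \<open>simp_all add: ct_def\<close>)
next
  fix x and zs :: "'a list" assume "length zs < length s"
  then have "length (sort zs) < b" using assms by simp
  then show "safe prog (ct B) (vlist (map VSym (sort zs)) # vlist (map VSym (x # zs)) # []) sort_step \<and>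
    den prog (vlist (map VSym (sort zs)) # vlist (map VSym (x # zs)) # []) sort_step =
    vlist (map VSym (sort (x # zs)))"
    by (simp add: insert_simps)
qed (use assms in \<open>simp_all add: length_prog\<close>)

lemmas sort_simps = calls_sort[THEN calls_result, simplified] calls_sort[THEN calls_safe, simplified]

lemma calls_symbol_ok:
  assumes xs: "\<And>x. x \<in> set xs \<Longrightarrow> listed b x" "length xs < b" and s: "length s < b"
    and y: "listed b y"
  shows "calls prog 7 [vlist (map VSym s), vlist (map vexample xs), VSym a, VNode n,
      vlist (map (vnode (label (ex_tree y))) (ex_nodes y)), vlist (map vedge (ex_edges y))]
    (vbool (\<forall>c \<in> set s. ch (ex_tree y) n c \<in> mult_sem (fit (obs (ex_set xs) a c)))) (ct B 7)"
proof (rule fold_calls[where ct = "ct B" and b = b and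
      F = "\<lambda>s. vbool (\<forall>c \<in> set s. ch (ex_tree y) n c \<in> mult_sem (fit (obs (ex_set xs) a c)))",
      OF _ prog_nth(8)])
  show "b * (cost (ct B) etrue + cost (ct B) symbol_ok_step
      + length [vlist (map vexample xs), VSym a, VNode n,
      vlist (map (vnode (label (ex_tree y))) (ex_nodes y)), vlist (map vedge (ex_edges y))] + 6) \<le> ct B 7"
    using powers(1)[of 4] powers(2)[of 2 4]
    by (intro cost_leI[where d = 4 and e = 5]) (simp_all add: ct_def)
next
  fix c s'
  show "safe prog (ct B)
      (vbool (\<forall>c \<in> set s'. ch (ex_tree y) n c \<in> mult_sem (fit (obs (ex_set xs) a c))) #
       vlist (map VSym (c # s')) # [vlist (map vexample xs), VSym a, VNode n,
      vlist (map (vnode (label (ex_tree y))) (ex_nodes y)), vlist (map vedge (ex_edges y))]) symbol_ok_step \<and>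
    den prog
      (vbool (\<forall>c \<in> set s'. ch (ex_tree y) n c \<in> mult_sem (fit (obs (ex_set xs) a c))) #
       vlist (map VSym (c # s')) # [vlist (map vexample xs), VSym a, VNode n,
      vlist (map (vnode (label (ex_tree y))) (ex_nodes y)), vlist (map vedge (ex_edges y))]) symbol_ok_step =
    vbool (\<forall>c \<in> set (c # s'). ch (ex_tree y) n c \<in> mult_sem (fit (obs (ex_set xs) a c)))"
    by (cases "ch (ex_tree y) n c" rule: nat_cases3)
      (auto simp: obs_simps[OF xs] count_simps[OF y] mem_fit_iff vobs_def)
qed (use s in \<open>simp_all add: length_prog\<close>)

lemmas symbol_ok_simps = calls_result[OF calls_symbol_ok] calls_safe[OF calls_symbol_ok]

lemma calls_node_ok:
  assumes xs: "\<And>x. x \<in> set xs \<Longrightarrow> listed b x" "length xs < b" and s: "length s < b"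
    and y: "listed b y" and len: "length ns < b"
  shows "calls prog 6 [vlist (map (vnode (label (ex_tree y))) ns), vlist (map VSym s), vlist (map vexample xs),
      vlist (map (vnode (label (ex_tree y))) (ex_nodes y)), vlist (map vedge (ex_edges y))]
    (vbool (\<forall>n \<in> set ns. node_ok (set s) (ex_set xs) (ex_tree y) n)) (ct B 6)"
proof (rule fold_calls[where ct = "ct B" and b = b and
      F = "\<lambda>ns. vbool (\<forall>n \<in> set ns. node_ok (set s) (ex_set xs) (ex_tree y) n)",
      OF _ prog_nth(7)])
  show "b * (cost (ct B) etrue + cost (ct B) node_ok_step
      + length [vlist (map VSym s), vlist (map vexample xs),
      vlist (map (vnode (label (ex_tree y))) (ex_nodes y)), vlist (map vedge (ex_edges y))] + 6) \<le> ct B 6"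
    using powers(1)[of 5] by (intro cost_leI[where d = 5 and e = 6]) (simp_all add: ct_def)
qed (use len in \<open>auto simp: length_prog vnode_def symbol_ok_simps[OF xs s y] node_ok_def\<close>)

lemmas node_ok_simps = calls_result[OF calls_node_ok] calls_safe[OF calls_node_ok]

lemma calls_check:
  assumes xs: "\<And>x. x \<in> set xs \<Longrightarrow> listed b x" "length xs < b" and s: "length s < b"
    and ys: "\<And>y. y \<in> set ys \<Longrightarrow> listed b y" "length ys < b"
  shows "calls prog 5 [vlist (map vexample ys), vlist (map VSym s), vlist (map vexample xs), VSym r]
    (vbool (\<forall>e \<in> ex_set ys. example_ok (set s) (ex_set xs) r e)) (ct B 5)"
proof (rule fold_calls[where ct = "ct B" and b = b and
      F = "\<lambda>ys. vbool (\<forall>e \<in> ex_set ys. example_ok (set s) (ex_set xs) r e)",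
      OF _ prog_nth(6)])
  show "b * (cost (ct B) etrue + cost (ct B) check_step
      + length [vlist (map VSym s), vlist (map vexample xs), VSym r] + 6) \<le> ct B 5"
    using powers(1)[of 6] powers(2)[of 1 6]
    by (intro cost_leI[where d = 6 and e = 7]) (simp_all add: ct_def)
next
  fix y ys' assume "y \<in> set ys"
  then have y: "listed b y" by (rule ys)
  then have "length (ex_nodes y) < b" "set (ex_nodes y) = nodes (ex_tree y)" by (auto simp: listed_def)
  then show "safe prog (ct B)
      (vbool (\<forall>e \<in> ex_set ys'. example_ok (set s) (ex_set xs) r e) #
       vlist (map vexample (y # ys')) # [vlist (map VSym s), vlist (map vexample xs), VSym r]) check_step \<and>
    den prog
      (vbool (\<forall>e \<in> ex_set ys'. example_ok (set s) (ex_set xs) r e) #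
       vlist (map vexample (y # ys')) # [vlist (map VSym s), vlist (map vexample xs), VSym r]) check_step =
    vbool (\<forall>e \<in> ex_set (y # ys'). example_ok (set s) (ex_set xs) r e)"
    by (auto simp: vexample_def root_label_simps[OF y] node_ok_simps[OF xs s y] example_ok_def)
qed (use ys in \<open>simp_all add: length_prog\<close>)

lemmas check_simps = calls_result[OF calls_check] calls_safe[OF calls_check]
lemmas rules_simps = calls_result[OF calls_rules] calls_safe[OF calls_rules]

lemma calls_main:
  assumes xs: "\<And>x. x \<in> set xs \<Longrightarrow> listed b x" "length xs < b" and s: "length s < b" "s \<noteq> []"
  defines "r \<equiv> root_label xs (hd (sort s))"
  shows "calls prog 0 [vlist (map VSym s), vlist (map vexample xs)]
    (if \<forall>e \<in> ex_set xs. example_ok (set s) (ex_set xs) r e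
     then VPair (VPair (VSym r) (vlist (map (\<lambda>a. VPair (VSym a) (vdme (fits (sort s) xs a))) (sort s)))) VNil
     else VNil) (ct B 0)"
proof (rule calls_bodyI[where ct = "ct B"], unfold prog_nth(1))
  show "cost (ct B) main_body \<le> ct B 0"
  proof -
    have "B ^ 8 = B * B ^ 7" using power_Suc[of B 7] by simp
    then have "1000 * B ^ 7 \<le> B ^ 8" using mult_le_mono1[OF B_ge, of "B ^ 7"] by metis
    then show ?thesis using powers(1)[of 7] powers(2)[of 2 7] by (simp add: ct_def)
  qed
  have "vfst (vlist (map VSym (sort s))) = VSym (hd (sort s))"
    using s(2) set_empty set_sort by (cases "sort s") (auto, metis set_empty set_sort)
  moreover have "length (sort s) < b" using s by simp
  ultimately show "safe prog (ct B) [vlist (map VSym s), vlist (map vexample xs)] main_body"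
    "den prog [vlist (map VSym s), vlist (map vexample xs)] main_body =
     (if \<forall>e \<in> ex_set xs. example_ok (set s) (ex_set xs) r e
     then VPair (VPair (VSym r) (vlist (map (\<lambda>a. VPair (VSym a) (vdme (fits (sort s) xs a))) (sort s)))) VNil
     else VNil)"
    using s xs by (simp_all add: sort_simps root_simps check_simps rules_simps r_def)
qed (simp add: length_prog)

end

section \<open>From representations to the lists that the program reads\<close>

lemma list_all2_eq_map: "list_all2 (\<lambda>x u. u = g x) xs vs \<Longrightarrow> vs = map g xs"
  by (induction rule: list_all2_induct) simp_all

text \<open>A choice along the list: it attaches to every example the enumerations of nodes and
  edges that its representation fixes.\<close>

lemma list_all2_witnesses:
  assumes "list_all2 R ys vs" "\<And>y v. y \<in> set ys \<Longrightarrow> R y v \<Longrightarrow> \<exists>x. h x = y \<and> v = g x \<and> Q x"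
  shows "\<exists>xs. map h xs = ys \<and> vs = map g xs \<and> (\<forall>x \<in> set xs. Q x)"
  using assms
proof (induction rule: list_all2_induct)
  case (Cons y ys v vs)
  then obtain xs where xs: "map h xs = ys" "vs = map g xs" "\<forall>x \<in> set xs. Q x" by auto
  from Cons obtain x where "h x = y" "v = g x" "Q x" by (metis list.set_intros(1))
  with xs show ?case by (intro exI[of _ "x # xs"]) simp
qed simp

lemma rep_example_listed:
  assumes "rep_example e v"
  obtains ns es where "v = vexample (e, ns, es)" "distinct ns" "set ns = nodes (fst e)"
    "distinct es" "set es = child (fst e)"
proof -
  obtain ns vs es ws where
    ns: "distinct ns" "set ns = nodes (fst e)"
      "list_all2 (\<lambda>n u. u = VPair (VNode n) (VSym (label (fst e) n))) ns vs" and
    es: "distinct es" "set es = child (fst e)"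
      "list_all2 (\<lambda>(m, n) u. u = VPair (VNode m) (VNode n)) es ws" and
    v: "v = VPair (vbool (snd e = Pos)) (VPair (VNode (root_node (fst e))) (VPair (vlist vs) (vlist ws)))"
    using assms by (auto simp: rep_example_def rep_tree_def rep_set_def)
  have vs: "vs = map (vnode (label (fst e))) ns"
    unfolding vnode_def by (rule list_all2_eq_map) (rule ns(3))
  have "list_all2 (\<lambda>p u. u = vedge p) es ws"
    using es(3) by (rule list_all2_mono) (auto simp: vedge_def)
  then have "ws = map vedge es" by (rule list_all2_eq_map)
  with v vs have "v = vexample (e, ns, es)" by (simp add: vexample_def)
  with ns es that show ?thesis by blast
qed

lemma root_label_cases:
  "if pos_roots (ex_set xs) = {} then root_label xs d = d else root_label xs d \<in> pos_roots (ex_set xs)"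
proof (induction xs)
  case Nil
  show ?case by (simp add: pos_roots_def)
next
  case (Cons x xs)
  have "pos_roots (ex_set (x # xs)) = pos_roots (ex_set xs) \<union>
    (if snd (fst x) = Pos then {label (ex_tree x) (root_node (ex_tree x))} else {})"
    by (cases "fst x") (auto simp: pos_roots_def)
  with Cons show ?case by auto
qed

lemma consistent_candidate_iff:
  assumes "finite \<Sigma>" "D \<subseteq> trees_pm \<Sigma>"
  shows "D \<subseteq> schema_lang_pm \<Sigma> (candidate \<Sigma> D r) \<longleftrightarrow> (\<forall>e \<in> D. example_ok \<Sigma> D r e)"
proof -
  have "(t, s) \<in> schema_lang_pm \<Sigma> (candidate \<Sigma> D r) \<longleftrightarrow> example_ok \<Sigma> D r (t, s)" if "(t, s) \<in> D" for t s
  proof -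
    have t: "t \<in> trees \<Sigma>" using assms(2) that by (auto simp: trees_pm_def)
    have "satisfies t (candidate \<Sigma> D r) \<longleftrightarrow>
        label t (root_node t) = r \<and> (\<forall>n \<in> nodes t. node_ok \<Sigma> D t n)"
      using satisfies_candidate_iff[OF assms(1) t] by (simp add: node_ok_def)
    then show ?thesis
      by (cases s) (simp_all add: example_ok_def t schema_lang_pm_Pos schema_lang_pm_Neg)
  qed
  then show ?thesis by (auto simp: subset_iff)
qed

text \<open>The sorted alphabet plays two roles: as the factor order it has to agree with
  \<open>sorted_list_of_set \<Sigma>\<close>, as the enumeration of the rules it is one of
  many.\<close>

lemma rep_schema_candidate:
  assumes "distinct s" "set s = \<Sigma>"
  shows "rep_schema (candidate \<Sigma> (ex_set xs) r)
    (VPair (VSym r) (vlist (map (\<lambda>a. VPair (VSym a) (vdme (fits (sort s) xs a))) (sort s))))"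
proof -
  let ?S = "candidate \<Sigma> (ex_set xs) r"
  have "sorted_list_of_set \<Sigma> = sort s"
    using assms by (metis distinct_remdups_id sorted_list_of_set_sort_remdups)
  then have rule: "the (rule ?S a) = fits (sort s) xs a" if "a \<in> \<Sigma>" for a
    using that by (simp add: candidate_def fits_def)
  have "dom (rule ?S) = \<Sigma>" by (auto simp: candidate_def split: if_splits)
  moreover have "list_all2 (\<lambda>a u. u = VPair (VSym a) (vdme (the (rule ?S a)))) (sort s)
      (map (\<lambda>a. VPair (VSym a) (vdme (fits (sort s) xs a))) (sort s))"
    using assms rule by (auto simp: list_all2_conv_all_nth) (metis length_sort nth_mem set_sort)
  ultimately have "rep_set (\<lambda>a u. u = VPair (VSym a) (vdme (the (rule ?S a)))) (dom (rule ?S))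
      (vlist (map (\<lambda>a. VPair (VSym a) (vdme (fits (sort s) xs a))) (sort s)))"
    unfolding rep_set_def
    by (intro exI[of _ "sort s"] exI[of _ "map (\<lambda>a. VPair (VSym a) (vdme (fits (sort s) xs a))) (sort s)"])
      (simp add: assms)
  then show ?thesis by (auto simp: rep_schema_def candidate_def)
qed

text \<open>For input size \<open>N\<close> all lists are shorter than \<open>b\<close>, the square
  of \<open>N + 1\<close>; the main function costs at most the 8th power of
  \<open>1000 * b\<close>.\<close>

lemma learner_computable:
  fixes \<Sigma> :: "'a::linorder set"
  assumes fin: "finite \<Sigma>"
  shows "computes_within prog (([:1000:] * [:1, 1:] ^ 2) ^ 8) example_size rep_example rep_schema
    \<Sigma> (trees_pm \<Sigma>) (learner \<Sigma>)"
  unfolding computes_within_def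
proof (intro allI impI, elim conjE)
  fix D :: "'a example set" and vA vD :: "'a val"
  assume D: "sample (trees_pm \<Sigma>) D" and vA: "rep_set rep_sym \<Sigma> vA" and vD: "rep_set rep_example D vD"
  define N where "N = card \<Sigma> + (\<Sum>e \<in> D. example_size e)"
  define b where "b = (N + 1) ^ 2"
  have finD: "finite D" and subD: "D \<subseteq> trees_pm \<Sigma>" "D \<noteq> {}" using D by (auto simp: sample_def)
  have b: "N < b" "N * N < b" by (simp_all add: b_def power2_eq_square)
  obtain s us where "distinct s" "set s = \<Sigma>" "list_all2 (\<lambda>a u. u = VSym a) s us" "vA = vlist us"
    using vA unfolding rep_set_def rep_sym_def by blast
  then have s: "distinct s" "set s = \<Sigma>" "vA = vlist (map VSym s)"
    using list_all2_eq_map[of VSym s us] by simp_all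
  have "length s = card \<Sigma>" using distinct_card[OF s(1)] s(2) by simp
  then have len_s: "length s < b" using b(1) by (simp add: N_def)
  have trees_D: "fst e \<in> trees \<Sigma>" if "e \<in> D" for e
    using subsetD[OF subD(1) that] by (auto simp: trees_pm_def)
  obtain e0 where "e0 \<in> D" using subD(2) by blast
  then have "\<Sigma> \<noteq> {}" using root_label_in_alphabet[OF trees_D] by blast
  then have "s \<noteq> []" using s by auto
  have listed: "\<exists>x. fst x = e \<and> v = vexample x \<and> listed b x" if e: "e \<in> D" and v: "rep_example e v" for e v
  proof -
    from v obtain ns es where x: "v = vexample (e, ns, es)" "distinct ns" "set ns = nodes (fst e)"
      "distinct es" "set es = child (fst e)" by (rule rep_example_listed)
    have t: "fst e \<in> trees \<Sigma>" using e by (rule trees_D)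
    have "length ns = example_size e"
      using distinct_card[OF x(2)] x(3) by (simp add: example_size_def tree_size_def)
    also have "\<dots> \<le> N" using member_le_sum[OF e _ finD, of example_size] by (simp add: N_def)
    finally have ns: "length ns \<le> N" .
    \<comment> \<open>The crude bound on the edges by pairs of nodes is the reason for the square in
      \<open>b\<close>.\<close>
    have "set es \<subseteq> set ns \<times> set ns" unfolding x(3,5) using t by (simp add: trees_def)
    then have "card (set es) \<le> card (set ns \<times> set ns)" by (rule card_mono[rotated]) simp
    then have "length es \<le> card (set ns \<times> set ns)" unfolding distinct_card[OF x(4)] .
    also have "\<dots> = length ns * length ns" using distinct_card[OF x(2)] by (simp add: card_cartesian_product)
    also have "\<dots> \<le> N * N" using ns by (intro mult_le_mono)
    finally have "length es < b" using b by simp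
    moreover have "length ns < b" using ns b by simp
    ultimately have "listed b (e, ns, es)"
      using x root_in_nodes[OF t] by (simp add: listed_def)
    then show ?thesis using x(1) by (intro exI[of _ "(e, ns, es)"]) simp
  qed
  from vD obtain ys vs where ys: "distinct ys" "set ys = D" "list_all2 rep_example ys vs" "vD = vlist vs"
    by (auto simp: rep_set_def)
  have "\<exists>x. fst x = e \<and> v = vexample x \<and> listed b x" if "e \<in> set ys" "rep_example e v" for e v
    using listed that unfolding ys(2) .
  from list_all2_witnesses[OF ys(3) this]
  obtain xs where "map fst xs = ys \<and> vs = map vexample xs \<and> (\<forall>x \<in> set xs. listed b x)" ..
  then have xs: "map fst xs = ys" "vs = map vexample xs" "\<And>x. x \<in> set xs \<Longrightarrow> listed b x" by simp_all
  have D_eq: "ex_set xs = D" using ys(2) unfolding xs(1)[symmetric] set_map .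
  \<comment> \<open>Every tree has a root, so the number of examples is bounded by the sum of their
    sizes.\<close>
  have "1 \<le> example_size e" if "e \<in> D" for e
    using finite_nodes[OF trees_D[OF that]] root_in_nodes[OF trees_D[OF that]]
    by (auto simp: example_size_def tree_size_def Suc_le_eq card_gt_0_iff)
  then have "card D \<le> (\<Sum>e \<in> D. example_size e)" using sum_mono[of D "\<lambda>_. 1" example_size] by simp
  moreover have "length xs = card D" 
    using distinct_card[OF ys(1)] ys(2) xs(1) length_map[of fst xs] by simp
  ultimately have len_xs: "length xs < b" using b(1) by (simp add: N_def)
  define r where "r = root_label xs (hd (sort s))"
  have "hd (sort s) = Min \<Sigma>"
  proof (cases "sort s")
    case Nil
    then show ?thesis using \<open>s \<noteq> []\<close> by (metis set_empty set_sort)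
  next
    case (Cons a l)
    have "set (a # l) = \<Sigma>" using s(2) Cons by (metis set_sort)
    moreover have "sorted (a # l)" using Cons by (metis sorted_sort)
    ultimately have "Min \<Sigma> = a" by (intro Min_eqI fin) auto
    then show ?thesis using Cons by simp
  qed
  then have r: "if pos_roots D = {} then r = Min \<Sigma> else r \<in> pos_roots D"
    using root_label_cases[of xs "hd (sort s)"] unfolding r_def D_eq
    by (simp split: if_splits)
  define v where "v = (if \<forall>e \<in> ex_set xs. example_ok (set s) (ex_set xs) r e
     then VPair (VPair (VSym r) (vlist (map (\<lambda>a. VPair (VSym a) (vdme (fits (sort s) xs a))) (sort s)))) VNil
     else VNil)"
  have "calls prog 0 [vA, vD] v (ct (1000 * b) 0)"
    unfolding v_def r_def s(3) ys(4) xs(2)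
    by (rule calls_main) (use b len_s len_xs xs(3) \<open>s \<noteq> []\<close> in auto)
  then obtain k where k: "k \<le> ct (1000 * b) 0" "runs prog [vA, vD] v k"
    by (auto simp: calls_def runs_def)
  have "ct (1000 * b) 0 = poly (([:1000:] * [:1, 1:] ^ 2) ^ 8) N"
  proof -
    have "poly [:1000:] N = 1000" "poly [:1, 1:] N = N + 1" by simp_all
    then show ?thesis by (simp only: ct_def b_def poly_power poly_mult nth_Cons_0)
  qed
  moreover have "rep_option rep_schema (learner \<Sigma> D) v"
    using rep_schema_candidate[OF s(1,2), of xs r]
    unfolding learner_eqI[OF fin D r] consistent_candidate_iff[OF fin subD(1)] v_def s(2) D_eq
    by simp
  ultimately show "\<exists>v k. runs prog [vA, vD] v k \<and> rep_option rep_schema (learner \<Sigma> D) v \<and>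
      k \<le> poly (([:1000:] * [:1, 1:] ^ 2) ^ 8) (card \<Sigma> + (\<Sum>e \<in> D. example_size e))"
    using k unfolding N_def by metis
qed

theorem theorem6p1:
  "learnable_ptd (trees_pm :: 'a::linorder set \<Rightarrow> 'a example set) MS schema_lang_pm
     example_size schema_size rep_example rep_schema"
  unfolding learnable_ptd_def
  using learner_computable sound_learner_learner complete_learner_learner by blast

end
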